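(* Let $K$ be a field of characteristic $p>0$ and $R=K[x_0,\dots,x_n]$ with homogeneous maximal ideal $\mathfrak{m}$. Let $f\in R$ be a homogeneous polynomial of degree $d$ whose Jacobian ideal $(\partial f/\partial x_0,\dots,\partial f/\partial x_n)$ is $\mathfrak{m}$-primary. If $p\geqslant nd-d-n$, then the Frobenius action \[F\colon[H^n_\mathfrak{m}(R/fR)]_{<0}\longrightarrow[H^n_\mathfrak{m}(R/fR)]_{<0}\] is injective.
   Context: $H^n_\mathfrak{m}(R/fR)$ is the $n$-th local cohomology module with its natural $\mathbf{Z}$-grading; $[\,\cdot\,]_{<0}$ denotes the sum of its negatively graded components. $F$ is the map on local cohomology induced by the Frobenius endomorphism $r\mapsto r^p$ of $R/fR$; it sends the degree $j$ component to the degree $pj$ component. *)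

theory Defs
  imports Main "HOL-Library.Poly_Mapping"
begin

text \<open>Polynomials in variables x_0, x_1, ... with coefficients in 'a, as finitely
supported functions from monomials (exponent vectors) to coefficients.
The ring R = K[x_0,...,x_n] is the subring of those polynomials that only
involve the variables x_0,...,x_n.\<close>

type_synonym 'a mpoly = "(nat \<Rightarrow>\<^sub>0 nat) \<Rightarrow>\<^sub>0 'a"

definition var :: "nat \<Rightarrow> 'a::comm_ring_1 mpoly" where
  "var i = Poly_Mapping.single (Poly_Mapping.single i 1) 1"

definition in_R :: "nat \<Rightarrow> 'a::zero mpoly \<Rightarrow> bool" where
  "in_R n q \<longleftrightarrow> (\<forall>m\<in>Poly_Mapping.keys q. Poly_Mapping.keys m \<subseteq> {0..n})"

definition tdeg :: "(nat \<Rightarrow>\<^sub>0 nat) \<Rightarrow> nat" where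
  "tdeg m = (\<Sum>i\<in>Poly_Mapping.keys m. Poly_Mapping.lookup m i)"

definition homogeneous :: "nat \<Rightarrow> 'a::zero mpoly \<Rightarrow> bool" where
  "homogeneous d q \<longleftrightarrow> (\<forall>m\<in>Poly_Mapping.keys q. tdeg m = d)"

definition pd :: "nat \<Rightarrow> 'a::comm_ring_1 mpoly \<Rightarrow> 'a mpoly" where
  "pd i q = (\<Sum>m\<in>Poly_Mapping.keys q. Poly_Mapping.single (m - Poly_Mapping.single i 1)
                              (of_nat (Poly_Mapping.lookup m i) * Poly_Mapping.lookup q m))"

text \<open>The Jacobian ideal (pd 0 f, ..., pd n f) of R is m-primary, m = (x_0,...,x_n):
its radical is m, i.e. it is contained in m (generators have zero constant term)
and some power of every variable lies in it.\<close>
definition jacobian_m_primary :: "nat \<Rightarrow> 'a::comm_ring_1 mpoly \<Rightarrow> bool" where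
  "jacobian_m_primary n f \<longleftrightarrow>
     (\<forall>j\<le>n. Poly_Mapping.lookup (pd j f) 0 = 0) \<and>
     (\<exists>N. \<forall>i\<le>n. \<exists>h. (\<forall>j\<le>n. in_R n (h j)) \<and> var i ^ N = (\<Sum>j\<le>n. h j * pd j f))"

definition X :: "nat set \<Rightarrow> 'a::comm_ring_1 mpoly" where
  "X S = (\<Prod>i\<in>S. var i)"

text \<open>Cech complex of M = R/fR on x_0,...,x_n: C^t = (+)_{|S|=t} M_{X_S}.
A cochain with common exponent k is given by numerators g, its S-component
being g S / X_S^k. The T-component of its Cech differential is
cech_num k g T / X_T^k.\<close>
definition cech_num :: "nat \<Rightarrow> (nat set \<Rightarrow> 'a::comm_ring_1 mpoly) \<Rightarrow> nat set \<Rightarrow> 'a mpoly" where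
  "cech_num k g T = (\<Sum>i\<in>T. (-1) ^ card {j\<in>T. j < i} * g (T - {i}) * var i ^ k)"

text \<open>a / X_T^k is zero in the localization (R/fR)_{X_T}.\<close>
definition loc_zero :: "nat \<Rightarrow> 'a::comm_ring_1 mpoly \<Rightarrow> nat set \<Rightarrow> 'a mpoly \<Rightarrow> bool" where
  "loc_zero n f T a \<longleftrightarrow> (\<exists>e q. in_R n q \<and> X T ^ e * a = q * f)"

abbreviation Sn :: "nat \<Rightarrow> nat \<Rightarrow> nat set" where
  "Sn n i \<equiv> {0..n} - {i}"

text \<open>An element of C^n = (+)_{i} (R/fR)_{X/x_i} given by numerators g (S_i-component
g(S_i)/X_{S_i}^k) with entries in R.\<close>
definition cochain_n :: "nat \<Rightarrow> nat \<Rightarrow> (nat set \<Rightarrow> 'a::comm_ring_1 mpoly) \<Rightarrow> bool" where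
  "cochain_n n k g \<longleftrightarrow> (\<forall>i\<le>n. in_R n (g (Sn n i)))"

definition cocycle_n :: "nat \<Rightarrow> 'a::comm_ring_1 mpoly \<Rightarrow> nat \<Rightarrow> (nat set \<Rightarrow> 'a mpoly) \<Rightarrow> bool" where
  "cocycle_n n f k g \<longleftrightarrow> loc_zero n f {0..n} (cech_num k g {0..n})"

text \<open>Its class in H^n_m(R/fR) is zero: it is the differential of some cochain in
C^{n-1} (components h U / X_U^m, common exponent m >= k).\<close>
definition class_zero_n :: "nat \<Rightarrow> 'a::comm_ring_1 mpoly \<Rightarrow> nat \<Rightarrow> (nat set \<Rightarrow> 'a mpoly) \<Rightarrow> bool" where
  "class_zero_n n f k g \<longleftrightarrow>
     (\<exists>m\<ge>k. \<exists>h. (\<forall>U. in_R n (h U)) \<and>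
        (\<forall>i\<le>n. loc_zero n f (Sn n i)
            (g (Sn n i) * X (Sn n i) ^ (m - k) - cech_num m h (Sn n i))))"

text \<open>The cochain lies in negative degrees: every component g(S_i)/X_{S_i}^k only
involves terms of degree (total degree of the numerator monomial) - k n < 0.\<close>
definition negative_n :: "nat \<Rightarrow> nat \<Rightarrow> (nat set \<Rightarrow> 'a::zero mpoly) \<Rightarrow> bool" where
  "negative_n n k g \<longleftrightarrow> (\<forall>i\<le>n. \<forall>m\<in>Poly_Mapping.keys (g (Sn n i)). tdeg m < k * n)"

end

theory Submission
  imports Defs "HOL-Computational_Algebra.Primes"
begin

text \<open>
  The connecting map of 0 \<rightarrow> R(-d) \<rightarrow> R \<rightarrow> R/fR \<rightarrow> 0 embeds \<open>H\<^sup>n(R/fR)\<close> into \<open>H\<^sup>n\<^sup>+\<^sup>1(R)(-d)\<close>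
  and turns Frobenius into \<open>f\<^sup>p\<^sup>-\<^sup>1 F\<close>. A class there is a fraction \<open>q / (x\<^sub>0 \<cdots> x\<^sub>n)\<^sup>K\<close>, and it vanishes
  iff \<open>q \<in> (x\<^sub>0\<^sup>K, \<dots>, x\<^sub>n\<^sup>K)\<close>. Suppose that \<open>f\<^sup>p\<^sup>-\<^sup>1 q\<^sup>p\<close> lies in \<open>(x\<^sub>i\<^sup>p\<^sup>K)\<close> and q does not lie in
  \<open>(x\<^sub>i\<^sup>K)\<close>. Let \<open>u = f\<^sup>t q\<^sup>p\<close> be the last product outside \<open>(x\<^sub>i\<^sup>p\<^sup>K)\<close>; then \<open>t \<le> p - 2\<close>. Partial
  derivatives preserve \<open>(x\<^sub>i\<^sup>p\<^sup>K)\<close> in characteristic p, so differentiating \<open>f\<^sup>t\<^sup>+\<^sup>1 q\<^sup>p\<close> shows that the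
  Jacobian ideal multiplies u into \<open>(x\<^sub>i\<^sup>p\<^sup>K)\<close>. By Macaulay's bound, a nonzero class annihilated by
  an \<open>m\<close>-primary ideal with n + 1 generators of degree d - 1 has degree at least -(n + 1)(d - 1),
  whereas the class of u has degree at most -2d - p.

  Macaulay's bound is obtained from the Koszul complex on \<open>x\<^sub>i\<^sup>N\<close> and the partial derivatives
  \<open>f\<^sub>j\<close> together. Cohomology in degrees up to n vanishes for \<open>x\<^sub>i\<^sup>N\<close>, hence for the joint sequence,
  hence for \<open>f\<^sub>j\<close> alone because \<open>x\<^sub>i\<^sup>N \<in> (f\<^sub>j)\<close>. Consequently \<open>H\<^sup>n\<^sup>+\<^sup>1\<close> of the joint complex embeds
  both into \<open>R/(x\<^sub>i\<^sup>N)\<close>, where its image is the annihilator of the \<open>f\<^sub>j\<close>, and into \<open>R/(f\<^sub>j)\<close>, which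
  has no elements of negative degree.
\<close>

section \<open>Koszul cochains\<close>

definition ksign :: "nat \<Rightarrow> nat set \<Rightarrow> 'r::comm_ring_1" where
  "ksign i T = (-1) ^ card {j\<in>T. j < i}"

text \<open>The Koszul cochain differential on \<open>a\<close>. With \<open>a i = var i ^ k\<close>
  it computes Cech numerators at common exponent k.\<close>

definition koszul :: "(nat \<Rightarrow> 'r::comm_ring_1) \<Rightarrow> (nat set \<Rightarrow> 'r) \<Rightarrow> nat set \<Rightarrow> 'r" where
  "koszul a c T = (\<Sum>i\<in>T. ksign i T * a i * c (T - {i}))"

text \<open>
  A cochain c on \<open>insert l I\<close> is the pair of its restriction to I and \<open>slice l c\<close>; \<open>glue\<close> is the inverse.
  With this choice of signs the differential of (z, w) is (dz, \<open>a\<^sub>l\<close> z - dw).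
\<close>
definition slice :: "nat \<Rightarrow> (nat set \<Rightarrow> 'r::comm_ring_1) \<Rightarrow> nat set \<Rightarrow> 'r" where
  "slice l c S = ksign l S * c (insert l S)"

definition glue :: "nat \<Rightarrow> (nat set \<Rightarrow> 'r::comm_ring_1) \<Rightarrow> (nat set \<Rightarrow> 'r) \<Rightarrow> nat set \<Rightarrow> 'r" where
  "glue l z w T = (if l \<in> T then ksign l (T - {l}) * w (T - {l}) else z T)"

lemma ksign_mult_self [simp]: "ksign i T * ksign i T = 1"
  by (simp add: ksign_def flip: power_add mult_2)

lemma ksign_mult_self_left [simp]: "ksign i T * (ksign i T * x) = x"
  by (simp flip: mult.assoc)

text \<open>Exactly one position changes parity: inserting l moves i if l < i, and removing i moves
  l if i < l.\<close>

lemma ksign_insert: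
  assumes "finite T" "l \<notin> T" "i \<in> T"
  shows "(ksign i (insert l T) :: 'r::comm_ring_1) = - (ksign l T * ksign i T * ksign l (T - {i}))"
proof (cases "l < i")
  case True
  have "{j\<in>insert l T. j < i} = insert l {j\<in>T. j < i}" using True by auto
  then have 1: "(ksign i (insert l T) :: 'r) = - ksign i T"
    using assms by (simp add: ksign_def)
  have "{j\<in>T - {i}. j < l} = {j\<in>T. j < l}" using True by auto
  then have "(ksign l (T - {i}) :: 'r) = ksign l T" by (simp add: ksign_def)
  with 1 show ?thesis by (simp add: mult.commute[of "ksign l T"] mult.assoc)
next
  case False
  then have "i < l" using assms by (metis linorder_neqE_nat)
  then have "{j\<in>T. j < l} = insert i {j\<in>T - {i}. j < l}" using assms by auto
  then have 2: "(ksign l T :: 'r) = - ksign l (T - {i})"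
    using assms by (simp add: ksign_def)
  have "{j\<in>insert l T. j < i} = {j\<in>T. j < i}" using \<open>i < l\<close> by auto
  then have "(ksign i (insert l T) :: 'r) = ksign i T" by (simp add: ksign_def)
  with 2 show ?thesis by (simp add: mult.commute[of "ksign l _"] mult.assoc)
qed

lemma koszul_cong:
  "(\<And>i. i \<in> T \<Longrightarrow> c (T - {i}) = c' (T - {i})) \<Longrightarrow> koszul a c T = koszul a c' T"
  by (simp add: koszul_def)

lemma koszul_add: "koszul a (\<lambda>S. c S + c' S) T = koszul a c T + koszul a c' T"
  by (simp add: koszul_def algebra_simps sum.distrib)

lemma koszul_diff: "koszul a (\<lambda>S. c S - c' S) T = koszul a c T - koszul a c' T"
  by (simp add: koszul_def algebra_simps sum_subtractf)

lemma koszul_uminus: "koszul a (\<lambda>S. - c S) T = - koszul a c T"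
  by (simp add: koszul_def sum_negf)

lemma koszul_mult: "koszul a (\<lambda>S. r * c S) T = r * koszul a c T"
  by (simp add: koszul_def sum_distrib_left algebra_simps)

lemma koszul_zero [simp]: "koszul a (\<lambda>S. 0) T = 0"
  by (simp add: koszul_def)

lemma koszul_sum: "koszul a (\<lambda>S. \<Sum>j\<in>J. c j S) T = (\<Sum>j\<in>J. koszul a (c j) T)"
  by (induction J rule: infinite_finite_induct) (simp_all add: koszul_add)

text \<open>The Koszul complex on one more element is the mapping cone of multiplication by
  \<open>a l\<close>. Every induction over index sets uses this recursion.\<close>

lemma koszul_insert:
  fixes a :: "nat \<Rightarrow> 'r::comm_ring_1"
  assumes "finite T" "l \<notin> T"
  shows "koszul a c (insert l T) = ksign l T * (a l * c T - koszul a (slice l c) T)"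
proof -
  have eq: "ksign i (insert l T) * a i * c (insert l T - {i}) =
      - (ksign l T * (ksign i T * a i * slice l c (T - {i})))" if "i \<in> T" for i
  proof -
    have "insert l T - {i} = insert l (T - {i})" using that assms by auto
    then show ?thesis
      using ksign_insert[OF assms that, where 'r = 'r] by (simp add: slice_def algebra_simps)
  qed
  have "{j\<in>insert l T. j < l} = {j\<in>T. j < l}" by auto
  then have "ksign l (insert l T) = (ksign l T :: 'r)" by (simp add: ksign_def)
  then have "koszul a c (insert l T) = ksign l T * a l * c T
      + (\<Sum>i\<in>T. ksign i (insert l T) * a i * c (insert l T - {i}))"
    using assms by (simp add: koszul_def)
  also have "(\<Sum>i\<in>T. ksign i (insert l T) * a i * c (insert l T - {i})) =
      - (ksign l T * koszul a (slice l c) T)"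
    unfolding koszul_def sum_distrib_left sum_negf[symmetric]
    by (intro sum.cong refl eq)
  finally show ?thesis by (simp add: algebra_simps)
qed

text \<open>The slice of db is \<open>a l\<close> b - d(slice b). Applying d and the induction
  hypothesis leaves \<open>a l\<close> db, which cancels the other term.\<close>

lemma koszul_koszul: "finite T \<Longrightarrow> koszul a (koszul a b) T = 0"
proof (induction T arbitrary: b rule: finite_induct)
  case empty
  then show ?case by (simp add: koszul_def)
next
  case (insert l T)
  have "koszul a (slice l (koszul a b)) T = koszul a (\<lambda>S. a l * b S - koszul a (slice l b) S) T"
  proof (rule koszul_cong)
    fix i
    have "finite (T - {i})" "l \<notin> T - {i}" using insert by auto
    then show "slice l (koszul a b) (T - {i}) = a l * b (T - {i}) - koszul a (slice l b) (T - {i})"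
      by (simp add: slice_def koszul_insert)
  qed
  also have "\<dots> = a l * koszul a b T"
    by (simp add: koszul_diff koszul_mult insert.IH)
  finally show ?case using insert.hyps by (simp add: koszul_insert)
qed

lemma slice_glue: "l \<notin> S \<Longrightarrow> slice l (glue l z w) S = w S"
  by (simp add: slice_def glue_def)

lemma koszul_glue: "l \<notin> T \<Longrightarrow> koszul a (glue l z w) T = koszul a z T"
  by (rule koszul_cong) (simp add: glue_def)

lemma koszul_slice_glue: "l \<notin> T \<Longrightarrow> koszul a (slice l (glue l z w)) T = koszul a w T"
  by (rule koszul_cong) (simp add: slice_glue)

section \<open>Koszul cohomology when the family grows or shrinks\<close>

text \<open>Only the values of c on subsets of I of the relevant size matter, so no support condition is imposed.\<close>
definition cocycle :: "(nat \<Rightarrow> 'r::comm_ring_1) \<Rightarrow> nat set \<Rightarrow> nat \<Rightarrow> (nat set \<Rightarrow> 'r) \<Rightarrow> bool" where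
  "cocycle a I i c \<longleftrightarrow> (\<forall>T\<subseteq>I. card T = Suc i \<longrightarrow> koszul a c T = 0)"

definition coboundary :: "(nat \<Rightarrow> 'r::comm_ring_1) \<Rightarrow> nat set \<Rightarrow> nat \<Rightarrow> (nat set \<Rightarrow> 'r) \<Rightarrow> bool" where
  "coboundary a I i c \<longleftrightarrow> (\<exists>b. \<forall>T\<subseteq>I. card T = i \<longrightarrow> c T = koszul a b T)"

definition acyclic_at :: "(nat \<Rightarrow> 'r::comm_ring_1) \<Rightarrow> nat set \<Rightarrow> nat \<Rightarrow> bool" where
  "acyclic_at a I i \<longleftrightarrow> (\<forall>c. cocycle a I i c \<longrightarrow> coboundary a I i c)"

lemma subset_insert_cases:
  assumes "T \<subseteq> insert l I" "l \<notin> I" "finite I"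
  obtains "T \<subseteq> I" "l \<notin> T"
  | T' where "T = insert l T'" "T' \<subseteq> I" "l \<notin> T'" "finite T'" "card T = Suc (card T')"
proof (cases "l \<in> T")
  case True
  have "finite T" using assms by (meson finite_insert finite_subset)
  with True assms that(2)[of "T - {l}"] show ?thesis
    by (metis Diff_insert_absorb Set.set_insert card_insert_disjoint finite_insert insert_ident subset_insert_iff)
next
  case False
  with assms that(1) show ?thesis by blast
qed

lemma cocycle_insert_iff:
  assumes "finite I" "l \<notin> I"
  shows "cocycle a (insert l I) i c \<longleftrightarrow>
    cocycle a I i c \<and> (\<forall>T\<subseteq>I. card T = i \<longrightarrow> a l * c T = koszul a (slice l c) T)"
proof (intro iffI conjI allI impI)
  assume *: "cocycle a (insert l I) i c"
  then show "cocycle a I i c" by (auto simp: cocycle_def)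
  fix T assume T: "T \<subseteq> I" "card T = i"
  then have fin: "finite T" "l \<notin> T" using assms by (auto intro: finite_subset)
  have "koszul a c (insert l T) = 0"
    using * T fin unfolding cocycle_def by (metis card_insert_disjoint insert_mono)
  then have "ksign l T * (ksign l T * (a l * c T - koszul a (slice l c) T)) = 0"
    using fin by (simp add: koszul_insert)
  then show "a l * c T = koszul a (slice l c) T" by simp
next
  assume *: "cocycle a I i c \<and> (\<forall>T\<subseteq>I. card T = i \<longrightarrow> a l * c T = koszul a (slice l c) T)"
  show "cocycle a (insert l I) i c"
    unfolding cocycle_def
  proof (intro allI impI)
    fix T assume T: "T \<subseteq> insert l I" "card T = Suc i"
    from T(1) assms(2,1) show "koszul a c T = 0"
    proof (cases rule: subset_insert_cases)
      case 1
      with * T show ?thesis by (simp add: cocycle_def)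
    next
      case (2 T')
      with * T show ?thesis by (simp add: koszul_insert)
    qed
  qed
qed

lemma coboundary_subset: "coboundary a I i c \<Longrightarrow> I' \<subseteq> I \<Longrightarrow> coboundary a I' i c"
  unfolding coboundary_def by (meson subset_trans)

text \<open>If z = db, then w - \<open>a l\<close> b is closed, because \<open>a l\<close> z = dw.
  Acyclicity one degree lower makes it exact, and the primitives glue. So restriction to I is
  injective on cohomology.\<close>

lemma coboundary_insert:
  assumes "finite I" "l \<notin> I" and acyc: "\<And>j. i = Suc j \<Longrightarrow> acyclic_at a I j"
    and coc: "cocycle a (insert l I) i c" and cob: "coboundary a I i c"
  shows "coboundary a (insert l I) i c"
proof -
  obtain b where b: "\<And>T. T \<subseteq> I \<Longrightarrow> card T = i \<Longrightarrow> c T = koszul a b T"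
    using cob by (auto simp: coboundary_def)
  define y where "y = (\<lambda>S. slice l c S - a l * b S)"
  \<comment> \<open>In degree 0 no set satisfies the premise, so any \<open>b2\<close>
    serves.\<close>
  have "\<exists>b2. \<forall>T\<subseteq>I. Suc (card T) = i \<longrightarrow> y T = koszul a b2 T"
  proof (cases i)
    case (Suc j)
    have "cocycle a I j y"
      using iffD1[OF cocycle_insert_iff[OF assms(1,2)] coc] b
      by (simp add: cocycle_def y_def koszul_diff koszul_mult Suc)
    with acyc[OF Suc] have "coboundary a I j y" by (simp add: acyclic_at_def)
    then show ?thesis by (simp add: coboundary_def Suc)
  qed simp
  then obtain b2 where b2: "\<And>T. T \<subseteq> I \<Longrightarrow> Suc (card T) = i \<Longrightarrow> y T = koszul a b2 T"
    by blast
  have "c T = koszul a (glue l b (\<lambda>S. - b2 S)) T" if T: "T \<subseteq> insert l I" "card T = i" for T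
    using T(1) assms(2,1)
  proof (cases rule: subset_insert_cases)
    case 1
    with b T show ?thesis by (simp add: koszul_glue)
  next
    case (2 T')
    have "koszul a (glue l b (\<lambda>S. - b2 S)) T = ksign l T' * (a l * b T' + koszul a b2 T')"
      using 2 by (simp add: koszul_insert koszul_slice_glue koszul_uminus) (simp add: glue_def)
    also have "\<dots> = ksign l T' * slice l c T'"
      using b2[of T', symmetric] 2 T by (simp add: y_def)
    finally show ?thesis using 2 by (simp add: slice_def)
  qed
  then show ?thesis by (auto simp: coboundary_def)
qed

text \<open>One index of F at a time: below r, the cohomology of the larger family embeds into that
  of the smaller one, which is zero.\<close>

lemma acyclic_at_union:
  assumes "finite F" "finite I" "F \<inter> I = {}"
    and "\<And>j. j < r \<Longrightarrow> acyclic_at a I j" and "j < r"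
  shows "acyclic_at a (F \<union> I) j"
proof -
  have "\<forall>j<r. acyclic_at a (F \<union> I) j"
    using assms(1,3)
  proof (induction F rule: finite_induct)
    case empty
    then show ?case using assms by simp
  next
    case (insert l F)
    then have IH: "\<forall>j<r. acyclic_at a (F \<union> I) j" by simp
    have fin: "finite (F \<union> I)" "l \<notin> F \<union> I" using insert assms by auto
    have "acyclic_at a (insert l (F \<union> I)) j" if "j < r" for j
      unfolding acyclic_at_def
    proof (intro allI impI)
      fix c assume c: "cocycle a (insert l (F \<union> I)) j c"
      then have "coboundary a (F \<union> I) j c"
        using IH that by (auto simp: acyclic_at_def cocycle_insert_iff[OF fin])
      with IH that fin c show "coboundary a (insert l (F \<union> I)) j c"
        by (intro coboundary_insert) auto
    qed
    then show ?case by simp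
  qed
  then show ?thesis using assms by blast
qed

lemma coboundary_union:
  assumes "finite F" "finite I" "F \<inter> I = {}"
    and acyc: "\<And>j. j < i \<Longrightarrow> acyclic_at a I j"
    and "cocycle a (F \<union> I) i c" and "coboundary a I i c"
  shows "coboundary a (F \<union> I) i c"
  using assms(1,3,5)
proof (induction F rule: finite_induct)
  case empty
  then show ?case using assms by simp
next
  case (insert l F)
  have fin: "finite (F \<union> I)" "l \<notin> F \<union> I" using insert assms by auto
  have c: "cocycle a (insert l (F \<union> I)) i c" using insert by simp
  then have "coboundary a (F \<union> I) i c"
    using insert by (intro insert.IH) (auto simp: cocycle_insert_iff[OF fin])
  moreover have "acyclic_at a (F \<union> I) j" if "i = Suc j" for j
    using insert assms(2) acyc that by (intro acyclic_at_union[of F I i]) auto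
  ultimately have "coboundary a (insert l (F \<union> I)) i c"
    using c fin by (intro coboundary_insert) auto
  then show ?case by simp
qed

text \<open>Contraction with j is a null-homotopy of multiplication by \<open>a j\<close>: gluing
  \<open>slice j c\<close> with 0 gives a primitive.\<close>

lemma coboundary_generator_mult:
  assumes "finite I" "j \<in> I" "cocycle a I i c"
  shows "coboundary a I i (\<lambda>T. a j * c T)"
proof -
  define I' where "I' = I - {j}"
  have I: "I = insert j I'" "j \<notin> I'" "finite I'" using assms by (auto simp: I'_def)
  have c: "\<And>T. T \<subseteq> I' \<Longrightarrow> card T = i \<Longrightarrow> a j * c T = koszul a (slice j c) T"
    using iffD1[OF cocycle_insert_iff[OF I(3,2)] assms(3)[unfolded I(1)]] by blast
  have "a j * c T = koszul a (glue j (slice j c) (\<lambda>S. 0)) T" if T: "T \<subseteq> insert j I'" "card T = i" for T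
    using T(1) I(2,3)
  proof (cases rule: subset_insert_cases)
    case 1
    with c T show ?thesis by (simp add: koszul_glue)
  next
    case (2 T')
    then show ?thesis
      by (simp add: koszul_insert koszul_slice_glue) (simp add: glue_def slice_def algebra_simps)
  qed
  then show ?thesis unfolding coboundary_def I(1) by blast
qed

lemma coboundary_ideal_mult:
  assumes "finite I" "cocycle a I i c" "r = (\<Sum>j\<in>I. h j * a j)"
  shows "coboundary a I i (\<lambda>T. r * c T)"
proof -
  have "\<forall>j\<in>I. \<exists>b. \<forall>T\<subseteq>I. card T = i \<longrightarrow> a j * c T = koszul a b T"
    using coboundary_generator_mult[OF assms(1) _ assms(2)] by (simp add: coboundary_def)
  then obtain b where b: "\<And>j T. j \<in> I \<Longrightarrow> T \<subseteq> I \<Longrightarrow> card T = i \<Longrightarrow> a j * c T = koszul a (b j) T"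
    by metis
  have "r * c T = koszul a (\<lambda>S. \<Sum>j\<in>I. h j * b j S) T" if "T \<subseteq> I" "card T = i" for T
    using that b by (simp add: assms(3) koszul_sum koszul_mult sum_distrib_right mult.assoc)
  then show ?thesis by (auto simp: coboundary_def)
qed

lemma cocycle_glue:
  assumes "finite I" "l \<notin> I" "cocycle a I i z"
    and "\<And>T. T \<subseteq> I \<Longrightarrow> card T = i \<Longrightarrow> a l * z T = koszul a w T"
  shows "cocycle a (insert l I) i (glue l z w)"
  unfolding cocycle_insert_iff[OF assms(1,2)]
proof (intro conjI allI impI)
  show "cocycle a I i (glue l z w)"
    unfolding cocycle_def
  proof (intro allI impI)
    fix T assume T: "T \<subseteq> I" "card T = Suc i"
    then have "l \<notin> T" using assms by auto
    with T assms(3) show "koszul a (glue l z w) T = 0" by (simp add: koszul_glue cocycle_def)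
  qed
  fix T assume T: "T \<subseteq> I" "card T = i"
  then have "l \<notin> T" using assms by auto
  with T assms(4) show "a l * glue l z w T = koszul a (slice l (glue l z w)) T"
    by (simp add: koszul_slice_glue) (simp add: glue_def)
qed

lemma coboundary_glueD:
  assumes "l \<notin> I" "coboundary a I i (glue l z w)"
  shows "coboundary a I i z"
proof -
  obtain b where b: "\<And>T. T \<subseteq> I \<Longrightarrow> card T = i \<Longrightarrow> glue l z w T = koszul a b T"
    using assms(2) by (auto simp: coboundary_def)
  have "z T = koszul a b T" if "T \<subseteq> I" "card T = i" for T
  proof -
    have "l \<notin> T" using that assms(1) by blast
    then show ?thesis using b[OF that] by (simp add: glue_def)
  qed
  then show ?thesis by (auto simp: coboundary_def)
qed

text \<open>As \<open>a l\<close> lies in the ideal of the others, it kills their cohomology. Hence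
  a cocycle on I extends to \<open>insert l I\<close>, and a primitive found there restricts to
  I.\<close>

lemma acyclic_at_remove:
  assumes "finite I" "l \<notin> I" "acyclic_at a (insert l I) i" "a l = (\<Sum>j\<in>I. h j * a j)"
  shows "acyclic_at a I i"
  unfolding acyclic_at_def
proof (intro allI impI)
  fix c assume c: "cocycle a I i c"
  then obtain w where "\<And>T. T \<subseteq> I \<Longrightarrow> card T = i \<Longrightarrow> a l * c T = koszul a w T"
    using coboundary_ideal_mult[OF assms(1) c assms(4)] by (auto simp: coboundary_def)
  then have "cocycle a (insert l I) i (glue l c w)"
    using assms c by (intro cocycle_glue)
  then have "coboundary a (insert l I) i (glue l c w)"
    using assms(3) by (simp add: acyclic_at_def)
  then show "coboundary a I i c"
    using assms(2) by (blast intro: coboundary_glueD coboundary_subset)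
qed

lemma acyclic_at_remove_union:
  assumes "finite F" "finite I" "F \<inter> I = {}" "acyclic_at a (F \<union> I) i"
    and "\<And>l. l \<in> F \<Longrightarrow> \<exists>h. a l = (\<Sum>j\<in>I. h j * a j)"
  shows "acyclic_at a I i"
  using assms(1,3,4,5)
proof (induction F rule: finite_induct)
  case (insert l F)
  obtain h where h: "a l = (\<Sum>j\<in>I. h j * a j)" using insert.prems by blast
  define h' where "h' j = (if j \<in> I then h j else 0)" for j
  have "(\<Sum>j\<in>F \<union> I. h' j * a j) = (\<Sum>j\<in>I. h' j * a j)"
    using insert assms(2) by (intro sum.mono_neutral_right) (auto simp: h'_def)
  also have "\<dots> = a l" using h by (simp add: h'_def)
  finally have h': "a l = (\<Sum>j\<in>F \<union> I. h' j * a j)" by (rule sym)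
  have fin: "finite (F \<union> I)" "l \<notin> F \<union> I" "acyclic_at a (insert l (F \<union> I)) i"
    using insert.hyps insert.prems(1,2) assms(2) by auto
  have "F \<inter> I = {}" using insert.prems(1) by auto
  moreover have "acyclic_at a (F \<union> I) i" by (rule acyclic_at_remove[OF fin h'])
  ultimately show ?case by (rule insert.IH) (simp add: insert.prems(3))
qed simp

text \<open>Top coboundaries form the ideal of I, so \<open>reg\<close> says that \<open>a l\<close>
  is a nonzerodivisor modulo it. This settles degree \<open>card I\<close>; lower degrees come from
  acyclicity on I.\<close>

lemma acyclic_at_regular_insert:
  assumes "finite I" "l \<notin> I" "\<And>j. j < card I \<Longrightarrow> acyclic_at a I j"
    and reg: "\<And>u b. a l * u = koszul a b I \<Longrightarrow> \<exists>b'. u = koszul a b' I"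
    and "j \<le> card I"
  shows "acyclic_at a (insert l I) j"
proof -
  have "coboundary a I j c" if c: "cocycle a (insert l I) j c" for c
  proof (cases "j < card I")
    case True
    then show ?thesis
      using assms c by (auto simp: acyclic_at_def cocycle_insert_iff)
  next
    case False
    then have j: "j = card I" using assms by simp
    have "a l * c I = koszul a (slice l c) I"
      using c by (auto simp: cocycle_insert_iff[OF assms(1,2)] j)
    with reg obtain b' where "c I = koszul a b' I" by blast
    moreover have "T = I" if "T \<subseteq> I" "card T = j" for T
      using that assms(1) j card_subset_eq by blast
    ultimately show ?thesis by (metis coboundary_def)
  qed
  then show ?thesis
    unfolding acyclic_at_def using assms by (auto intro!: coboundary_insert)
qed

section \<open>Monomials and ideals of variable powers\<close>

definition mfilter :: "('m \<Rightarrow> bool) \<Rightarrow> ('m \<Rightarrow>\<^sub>0 'b) \<Rightarrow> ('m \<Rightarrow>\<^sub>0 'b::zero)" where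
  "mfilter P q = Poly_Mapping.mapp (\<lambda>m c. c when P m) q"

lemma lookup_mfilter: "Poly_Mapping.lookup (mfilter P q) m = (Poly_Mapping.lookup q m when P m)"
  by (auto simp: mfilter_def lookup_mapp when_def in_keys_iff)

lemma keys_mfilter: "Poly_Mapping.keys (mfilter P q) = {m\<in>Poly_Mapping.keys q. P m}"
  by (auto simp: in_keys_iff lookup_mfilter)

lemma mfilter_add: "mfilter P (q + r) = mfilter P q + mfilter P r"
  by (rule poly_mapping_eqI) (simp add: lookup_mfilter lookup_add when_add_distrib)

lemma mfilter_zero [simp]: "mfilter P 0 = 0"
  by (rule poly_mapping_eqI) (simp add: lookup_mfilter)

lemma mfilter_sum: "mfilter P (\<Sum>i\<in>A. q i) = (\<Sum>i\<in>A. mfilter P (q i))"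
  by (induction A rule: infinite_finite_induct) (simp_all add: mfilter_add)

lemma mfilter_id: "(\<And>m. m \<in> Poly_Mapping.keys q \<Longrightarrow> P m) \<Longrightarrow> mfilter P q = q"
  by (rule poly_mapping_eqI) (auto simp: lookup_mfilter when_def in_keys_iff)

lemma mfilter_eq_zero: "(\<And>m. m \<in> Poly_Mapping.keys q \<Longrightarrow> \<not> P m) \<Longrightarrow> mfilter P q = 0"
  by (rule poly_mapping_eqI) (auto simp: lookup_mfilter when_def in_keys_iff)

text \<open>Splitting q by P' splits the product by P. This serves degree truncation, the retraction
  onto R and division by f.\<close>

lemma mfilter_mult:
  assumes "\<And>t m. t \<in> Poly_Mapping.keys a \<Longrightarrow> P (t + m) \<longleftrightarrow> P' m"
  shows "mfilter P (a * q) = a * mfilter P' q"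
proof -
  have "q = mfilter P' q + mfilter (\<lambda>m. \<not> P' m) q"
    by (rule poly_mapping_eqI) (auto simp: lookup_mfilter lookup_add when_def)
  then have "mfilter P (a * q) = mfilter P (a * mfilter P' q) + mfilter P (a * mfilter (\<lambda>m. \<not> P' m) q)"
    by (metis distrib_left mfilter_add)
  also have "mfilter P (a * mfilter P' q) = a * mfilter P' q"
    using keys_mult[of a "mfilter P' q"] assms by (intro mfilter_id) (auto simp: keys_mfilter)
  also have "mfilter P (a * mfilter (\<lambda>m. \<not> P' m) q) = 0"
    using keys_mult[of a "mfilter (\<lambda>m. \<not> P' m) q"] assms
    by (intro mfilter_eq_zero) (auto simp: keys_mfilter)
  finally show ?thesis by simp
qed

lemma keys_uminus [simp]: "Poly_Mapping.keys (- q) = Poly_Mapping.keys (q :: 'm \<Rightarrow>\<^sub>0 'b::ab_group_add)"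
  by (auto simp: in_keys_iff)

lemma keys_sum_subset:
  "Poly_Mapping.keys (\<Sum>i\<in>A. q i) \<subseteq> (\<Union>i\<in>A. Poly_Mapping.keys (q i))"
proof (induction A rule: infinite_finite_induct)
  case (insert i A)
  then show ?case using keys_add[of "q i" "sum q A"] by auto
qed auto

lemma sum_single_lookup:
  "(\<Sum>m\<in>Poly_Mapping.keys q. Poly_Mapping.single m (Poly_Mapping.lookup q m)) = q"
  by (rule poly_mapping_eqI)
    (auto simp: lookup_sum lookup_single when_def sum.delta in_keys_iff)

lemma tdeg_eq_sum:
  assumes "finite A" "Poly_Mapping.keys m \<subseteq> A"
  shows "tdeg m = (\<Sum>i\<in>A. Poly_Mapping.lookup m i)"
  unfolding tdeg_def using assms by (intro sum.mono_neutral_left) (auto simp: in_keys_iff)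

lemma tdeg_add: "tdeg (m + m') = tdeg m + tdeg m'"
proof -
  define A where "A = Poly_Mapping.keys m \<union> Poly_Mapping.keys m'"
  have "finite A" "Poly_Mapping.keys m \<subseteq> A" "Poly_Mapping.keys m' \<subseteq> A"
    "Poly_Mapping.keys (m + m') \<subseteq> A"
    using keys_add[of m m'] by (auto simp: A_def)
  then show ?thesis by (simp add: tdeg_eq_sum[of A] lookup_add sum.distrib)
qed

lemma tdeg_zero [simp]: "tdeg 0 = 0"
  by (simp add: tdeg_def)

lemma tdeg_single [simp]: "tdeg (Poly_Mapping.single i k) = k"
  by (simp add: tdeg_def)

lemma tdeg_sum: "tdeg (\<Sum>i\<in>A. m i) = (\<Sum>i\<in>A. tdeg (m i))"
  by (induction A rule: infinite_finite_induct) (simp_all add: tdeg_add)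

lemma homogeneous_one [simp]: "homogeneous 0 1"
  by (simp add: homogeneous_def)

lemma homogeneous_uminus [simp]: "homogeneous d (- q) \<longleftrightarrow> homogeneous d (q :: 'a::comm_ring_1 mpoly)"
  by (simp add: homogeneous_def)

lemma homogeneous_mult:
  "homogeneous d q \<Longrightarrow> homogeneous d' r \<Longrightarrow> homogeneous (d + d') (q * r)"
  using keys_mult[of q r] by (force simp: homogeneous_def tdeg_add)

lemma homogeneous_power: "homogeneous d q \<Longrightarrow> homogeneous (k * d) (q ^ k)"
  for q :: "'a::comm_ring_1 mpoly"
  by (induction k) (auto intro: homogeneous_mult)

lemma homogeneous_ksign [simp]: "homogeneous 0 (ksign i T :: 'a::comm_ring_1 mpoly)"
proof -
  have "homogeneous 0 (- 1 :: 'a mpoly)" by simp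
  from homogeneous_power[OF this] show ?thesis by (simp add: ksign_def)
qed

lemma var_power: "var i ^ k = Poly_Mapping.single (Poly_Mapping.single i k) 1"
  by (induction k) (simp_all add: var_def mult_single flip: single_add)

lemma homogeneous_var_power: "homogeneous k (var i ^ k :: 'a::comm_ring_1 mpoly)"
  by (auto simp: var_power homogeneous_def)

lemma X_power: "finite T \<Longrightarrow> X T ^ k = Poly_Mapping.single (\<Sum>i\<in>T. Poly_Mapping.single i k) 1"
proof (induction T rule: finite_induct)
  case (insert i T)
  then show ?case
    by (simp add: X_def power_mult_distrib var_power mult_single)
qed (simp add: X_def)

lemma monomial_mult_eq_sum:
  "Poly_Mapping.single t 1 * q
    = (\<Sum>m\<in>Poly_Mapping.keys q. Poly_Mapping.single (t + m) (Poly_Mapping.lookup q m))"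
  for q :: "'a::comm_ring_1 mpoly"
proof -
  have "Poly_Mapping.single t 1 * q = Poly_Mapping.single t 1 *
      (\<Sum>m\<in>Poly_Mapping.keys q. Poly_Mapping.single m (Poly_Mapping.lookup q m))"
    by (simp add: sum_single_lookup)
  then show ?thesis by (simp add: sum_distrib_left mult_single)
qed

lemma lookup_monomial_mult:
  "Poly_Mapping.lookup (Poly_Mapping.single t 1 * q) (t + m) = Poly_Mapping.lookup q m"
  for q :: "'a::comm_ring_1 mpoly"
  unfolding monomial_mult_eq_sum
  by (auto simp: lookup_sum lookup_single when_def sum.delta in_keys_iff)

lemma keys_monomial_mult:
  "Poly_Mapping.keys (Poly_Mapping.single t 1 * q) = (+) t ` Poly_Mapping.keys q"
  for q :: "'a::comm_ring_1 mpoly"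
proof
  show "Poly_Mapping.keys (Poly_Mapping.single t 1 * q) \<subseteq> (+) t ` Poly_Mapping.keys q"
    using keys_mult[of "Poly_Mapping.single t 1" q] by auto
  show "(+) t ` Poly_Mapping.keys q \<subseteq> Poly_Mapping.keys (Poly_Mapping.single t 1 * q)"
    by (auto simp: in_keys_iff lookup_monomial_mult)
qed

text \<open>Coefficients may involve all variables; they are brought into R only when a Cech class
  has to be killed.\<close>

definition in_powers :: "nat \<Rightarrow> nat set \<Rightarrow> 'a::comm_ring_1 mpoly \<Rightarrow> bool" where
  "in_powers N A q \<longleftrightarrow> (\<exists>b. q = (\<Sum>i\<in>A. b i * var i ^ N))"

lemma in_powers_sum:
  assumes "\<And>m. m \<in> M \<Longrightarrow> in_powers N A (q m)"
  shows "in_powers N A (\<Sum>m\<in>M. q m)"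
proof -
  have "\<forall>m\<in>M. \<exists>b. q m = (\<Sum>i\<in>A. b i * var i ^ N)" using assms by (simp add: in_powers_def)
  then obtain b where "\<forall>m\<in>M. q m = (\<Sum>i\<in>A. b m i * var i ^ N)" by metis
  then have "(\<Sum>m\<in>M. q m) = (\<Sum>i\<in>A. (\<Sum>m\<in>M. b m i) * var i ^ N)"
    by (simp add: sum_distrib_right) (rule sum.swap)
  then show ?thesis
    unfolding in_powers_def by (intro exI[of _ "\<lambda>i. \<Sum>m\<in>M. b m i"])
qed

lemma in_powers_mult: "in_powers N A q \<Longrightarrow> in_powers N A (r * q)"
  unfolding in_powers_def by (metis (no_types, lifting) mult.assoc sum.cong sum_distrib_left)

text \<open>Monomial ideals are tested monomial by monomial, so membership becomes a question about
  exponents.\<close>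

lemma in_powers_iff:
  assumes "finite A"
  shows "in_powers N A q \<longleftrightarrow> (\<forall>m\<in>Poly_Mapping.keys q. \<exists>i\<in>A. N \<le> Poly_Mapping.lookup m i)"
proof
  assume "in_powers N A q"
  then obtain b where b: "q = (\<Sum>i\<in>A. b i * var i ^ N)" by (auto simp: in_powers_def)
  show "\<forall>m\<in>Poly_Mapping.keys q. \<exists>i\<in>A. N \<le> Poly_Mapping.lookup m i"
  proof
    fix m assume "m \<in> Poly_Mapping.keys q"
    then obtain i where i: "i \<in> A" "m \<in> Poly_Mapping.keys (b i * var i ^ N)"
      using keys_sum_subset[of "\<lambda>i. b i * var i ^ N" A] b by blast
    then obtain s where "m = s + Poly_Mapping.single i N"
      using keys_mult[of "b i" "var i ^ N"] by (auto simp: var_power split: if_splits)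
    then have "N \<le> Poly_Mapping.lookup m i" by (simp add: lookup_add)
    with i show "\<exists>i\<in>A. N \<le> Poly_Mapping.lookup m i" by blast
  qed
next
  assume *: "\<forall>m\<in>Poly_Mapping.keys q. \<exists>i\<in>A. N \<le> Poly_Mapping.lookup m i"
  have "in_powers N A (Poly_Mapping.single m (Poly_Mapping.lookup q m))"
    if m_in: "m \<in> Poly_Mapping.keys q" for m
  proof -
    obtain i where i: "i \<in> A" "N \<le> Poly_Mapping.lookup m i" using * m_in by blast
    have m: "m - Poly_Mapping.single i N + Poly_Mapping.single i N = m"
      using i by (intro poly_mapping_eqI) (auto simp: lookup_add lookup_minus lookup_single when_def)
    have "Poly_Mapping.single m (Poly_Mapping.lookup q m) =
        Poly_Mapping.single (m - Poly_Mapping.single i N) (Poly_Mapping.lookup q m) * var i ^ N"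
      by (simp add: var_power mult_single m)
    also have "\<dots> = (\<Sum>j\<in>A. (if j = i then Poly_Mapping.single (m - Poly_Mapping.single i N)
        (Poly_Mapping.lookup q m) else 0) * var j ^ N)"
      using i assms by (simp add: if_distrib[of "\<lambda>x. x * _"] sum.delta cong: if_cong)
    finally show ?thesis unfolding in_powers_def
      by (intro exI[of _ "\<lambda>j. if j = i then Poly_Mapping.single (m - Poly_Mapping.single i N)
        (Poly_Mapping.lookup q m) else 0"])
  qed
  then have "in_powers N A (\<Sum>m\<in>Poly_Mapping.keys q. Poly_Mapping.single m (Poly_Mapping.lookup q m))"
    by (rule in_powers_sum)
  then show "in_powers N A q" by (simp add: sum_single_lookup)
qed

text \<open>A power of \<open>var l\<close> leaves the exponents at A untouched. This is the
  regularity of the variable powers.\<close>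

lemma in_powers_var_cancel:
  assumes "finite A" "l \<notin> A" "in_powers N A (var l ^ k * q)"
  shows "in_powers N A q"
proof -
  have "\<exists>i\<in>A. N \<le> Poly_Mapping.lookup (Poly_Mapping.single l k + m) i"
    if "m \<in> Poly_Mapping.keys q" for m
    using assms that by (simp add: in_powers_iff var_power keys_monomial_mult)
  moreover have "Poly_Mapping.lookup (Poly_Mapping.single l k + m) i = Poly_Mapping.lookup m i"
    if "i \<in> A" for i m
    using that assms(2) by (auto simp: lookup_add lookup_single when_def)
  ultimately show ?thesis using assms(1) by (simp add: in_powers_iff)
qed

text \<open>All exponents at A shift by M. So vanishing of a fraction's class survives expansion by
  \<open>X A ^ M\<close>, in both directions.\<close>

lemma in_powers_X_mult:
  assumes "finite A"
  shows "in_powers (N + M) A (X A ^ M * q) \<longleftrightarrow> in_powers N A q"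
proof -
  have "Poly_Mapping.lookup ((\<Sum>i\<in>A. Poly_Mapping.single i M) + m) i = M + Poly_Mapping.lookup m i"
    if "i \<in> A" for i m
    using that assms by (simp add: lookup_add lookup_sum lookup_single when_def sum.delta)
  then show ?thesis using assms by (simp add: in_powers_iff X_power keys_monomial_mult)
qed

lemma single_power: "Poly_Mapping.single m c ^ k = Poly_Mapping.single (\<Sum>j<k. m) (c ^ k)"
  for c :: "'a::comm_ring_1"
  by (induction k) (simp_all add: mult_single add.commute)

lemma CHAR_mpoly: "CHAR('a::comm_ring_1 mpoly) = CHAR('a)"
proof (rule CHAR_eqI)
  have "(of_nat CHAR('a) :: 'a mpoly) = Poly_Mapping.single 0 (of_nat CHAR('a))"
    by (rule single_of_nat[symmetric])
  then show "of_nat CHAR('a) = (0 :: 'a mpoly)" by simp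
  fix k assume "of_nat k = (0 :: 'a mpoly)"
  then have "Poly_Mapping.lookup (of_nat k :: 'a mpoly) 0 = 0" by simp
  then have "of_nat k = (0 :: 'a)" by (simp add: lookup_of_nat)
  then show "CHAR('a) dvd k" by (simp add: of_nat_eq_0_iff_char_dvd)
qed

text \<open>The p-th power multiplies exponent vectors by p and raises coefficients to the p-th
  power, so no monomial of q cancels.\<close>

lemma in_powers_frobeniusD:
  fixes q :: "'a::idom mpoly"
  assumes "finite A" "prime CHAR('a)" "in_powers (CHAR('a) * K) A (q ^ CHAR('a))"
  shows "in_powers K A q"
proof -
  let ?p = "CHAR('a)"
  define e where "e m = (\<Sum>j<?p. m)" for m :: "nat \<Rightarrow>\<^sub>0 nat"
  have lookup_e: "Poly_Mapping.lookup (e m) i = ?p * Poly_Mapping.lookup m i" for m i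
    unfolding e_def lookup_sum by simp
  have "?p > 0" using assms(2) prime_gt_0_nat by blast
  then have inj: "e m = e m' \<longleftrightarrow> m = m'" for m m'
    by (metis lookup_e mult_left_cancel poly_mapping_eqI less_numeral_extra(3))
  have "q ^ ?p = (\<Sum>m\<in>Poly_Mapping.keys q. Poly_Mapping.single m (Poly_Mapping.lookup q m)) ^ ?p"
    by (simp add: sum_single_lookup)
  also have "\<dots> = (\<Sum>m\<in>Poly_Mapping.keys q. Poly_Mapping.single m (Poly_Mapping.lookup q m) ^ ?p)"
    using assms(2) by (intro freshmans_dream_sum) (auto simp: CHAR_mpoly)
  also have "\<dots> = (\<Sum>m\<in>Poly_Mapping.keys q. Poly_Mapping.single (e m) (Poly_Mapping.lookup q m ^ ?p))"
    by (simp add: single_power e_def)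
  finally have qp: "q ^ ?p = \<dots>" .
  have key: "e m \<in> Poly_Mapping.keys (q ^ ?p)" if "m \<in> Poly_Mapping.keys q" for m
  proof -
    have "Poly_Mapping.lookup (q ^ ?p) (e m) = Poly_Mapping.lookup q m ^ ?p"
      using that by (simp add: qp lookup_sum lookup_single inj when_def sum.delta)
    with that show ?thesis by (simp add: in_keys_iff)
  qed
  have "\<exists>i\<in>A. K \<le> Poly_Mapping.lookup m i" if "m \<in> Poly_Mapping.keys q" for m
    using assms(1,3) key[OF that] \<open>?p > 0\<close> by (force simp: in_powers_iff lookup_e)
  then show ?thesis using assms(1) by (simp add: in_powers_iff)
qed

section \<open>The Koszul complex of variable powers and Macaulay's bound\<close>

lemma koszul_image_iff:
  assumes "finite T"
  shows "(\<exists>b. u = koszul a b T) \<longleftrightarrow> (\<exists>h. u = (\<Sum>i\<in>T. h i * a i))"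
proof
  assume "\<exists>b. u = koszul a b T"
  then obtain b where "u = koszul a b T" by blast
  then have "u = (\<Sum>i\<in>T. (ksign i T * b (T - {i})) * a i)" by (simp add: koszul_def mult_ac)
  then show "\<exists>h. u = (\<Sum>i\<in>T. h i * a i)"
    by (intro exI[of _ "\<lambda>i. ksign i T * b (T - {i})"])
next
  assume "\<exists>h. u = (\<Sum>i\<in>T. h i * a i)"
  then obtain h where h: "u = (\<Sum>i\<in>T. h i * a i)" by blast
  define b where "b S = ksign (the_elem (T - S)) T * h (the_elem (T - S))" for S
  have "T - (T - {i}) = {i}" if "i \<in> T" for i using that by auto
  then have "koszul a b T = u"
    unfolding koszul_def h b_def by (intro sum.cong) (simp_all add: mult_ac)
  then show "\<exists>b. u = koszul a b T" by blast
qed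

lemma koszul_image_var_iff:
  assumes "finite T" "\<And>i. i \<in> T \<Longrightarrow> a i = var i ^ N"
  shows "(\<exists>b. u = koszul a b T) \<longleftrightarrow> in_powers N T u"
  unfolding koszul_image_iff[OF assms(1)] in_powers_def using assms(2) by simp

lemma acyclic_at_var:
  assumes "\<And>i. i < m \<Longrightarrow> a i = var i ^ N" "j < m"
  shows "acyclic_at a {0..<m} j"
proof -
  have "\<forall>j<m. acyclic_at a {0..<m} j"
    using assms(1)
  proof (induction m)
    case (Suc m)
    have "acyclic_at a (insert m {0..<m}) j" if "j \<le> m" for j
    proof (rule acyclic_at_regular_insert)
      fix u b assume *: "a m * u = koszul a b {0..<m}"
      have iff: "(\<exists>b. v = koszul a b {0..<m}) \<longleftrightarrow> in_powers N {0..<m} v" for v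
        using Suc by (intro koszul_image_var_iff) auto
      have "in_powers N {0..<m} (var m ^ N * u)"
        using * Suc.prems[of m] iff[of "a m * u"] by auto
      then have "in_powers N {0..<m} u" by (rule in_powers_var_cancel[rotated -1]) auto
      then show "\<exists>b'. u = koszul a b' {0..<m}" using iff by simp
    qed (use that Suc in auto)
    moreover have "insert m {0..<m} = {0..<Suc m}" by auto
    ultimately show ?case by (simp add: less_Suc_eq_le)
  qed simp
  with assms show ?thesis by blast
qed

text \<open>
  With \<open>a\<^sub>i\<close> homogeneous of degree \<open>D i\<close>, the differential preserves this shifted degree bound; \<open>\<sigma>\<close> may be negative.
\<close>
definition deg_less :: "(nat \<Rightarrow> nat) \<Rightarrow> int \<Rightarrow> nat set \<Rightarrow> (nat set \<Rightarrow> 'a::zero mpoly) \<Rightarrow> bool" where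
  "deg_less D \<sigma> I c \<longleftrightarrow>
    (\<forall>T\<subseteq>I. \<forall>m\<in>Poly_Mapping.keys (c T). int (tdeg m) < \<sigma> + (\<Sum>i\<in>T. int (D i)))"

definition trunc :: "(nat \<Rightarrow> nat) \<Rightarrow> int \<Rightarrow> (nat set \<Rightarrow> 'a::zero mpoly) \<Rightarrow> nat set \<Rightarrow> 'a mpoly" where
  "trunc D \<sigma> c T = mfilter (\<lambda>m. int (tdeg m) < \<sigma> + (\<Sum>i\<in>T. int (D i))) (c T)"

text \<open>Multiplication by \<open>a i\<close> raises degrees by exactly \<open>D i\<close>, the
  difference between the bounds at T and at \<open>T - {i}\<close>.\<close>

lemma koszul_trunc:
  fixes a :: "nat \<Rightarrow> 'a::comm_ring_1 mpoly"
  assumes "finite T" "\<And>i. i \<in> T \<Longrightarrow> homogeneous (D i) (a i)"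
  shows "koszul a (trunc D \<sigma> c) T = trunc D \<sigma> (koszul a c) T"
  unfolding trunc_def koszul_def mfilter_sum
proof (rule sum.cong, rule refl)
  fix i assume i: "i \<in> T"
  have "homogeneous (0 + D i) (ksign i T * a i)"
    using assms i by (intro homogeneous_mult) auto
  moreover have "(\<Sum>j\<in>T. int (D j)) = int (D i) + (\<Sum>j\<in>T - {i}. int (D j))"
    using assms i by (simp add: sum.remove)
  ultimately show "ksign i T * a i * mfilter (\<lambda>m. int (tdeg m) < \<sigma> + (\<Sum>i\<in>T - {i}. int (D i))) (c (T - {i}))
      = mfilter (\<lambda>m. int (tdeg m) < \<sigma> + (\<Sum>i\<in>T. int (D i))) (ksign i T * a i * c (T - {i}))"
    by (intro mfilter_mult[symmetric]) (auto simp: homogeneous_def tdeg_add)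
qed

text \<open>Indices of F are adjoined one at a time: \<open>a l\<close> z = dw allows the extension
  (z, w). The degree bound and the annihilation by the remaining indices have to be kept.\<close>

lemma cocycle_lift:
  fixes a :: "nat \<Rightarrow> 'a::comm_ring_1 mpoly"
  assumes "finite F" "finite I" "F \<inter> I = {}" "\<And>j. j < r \<Longrightarrow> acyclic_at a I j"
    and "\<And>i. i \<in> F \<union> I \<Longrightarrow> homogeneous (D i) (a i)"
    and "cocycle a I r z" "deg_less D \<sigma> I z"
    and "\<And>l. l \<in> F \<Longrightarrow> coboundary a I r (\<lambda>T. a l * z T)"
  shows "\<exists>c. cocycle a (F \<union> I) r c \<and> deg_less D \<sigma> (F \<union> I) c \<and> (\<forall>T\<subseteq>I. c T = z T)"
  using assms
proof (induction F arbitrary: I z rule: finite_induct)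
  case empty
  then show ?case by auto
next
  case (insert l F)
  note fin = \<open>finite I\<close>
  have l: "l \<notin> I" using insert.prems by auto
  obtain w0 where w0: "\<And>T. T \<subseteq> I \<Longrightarrow> card T = r \<Longrightarrow> a l * z T = koszul a w0 T"
    using insert.prems(7)[of l] by (auto simp: coboundary_def)
  define w where "w = trunc D (\<sigma> + int (D l)) w0"
  have w: "a l * z T = koszul a w T" if T: "T \<subseteq> I" "card T = r" for T
  proof -
    have "finite T" using T fin finite_subset by blast
    then have "koszul a w T = trunc D (\<sigma> + int (D l)) (koszul a w0) T"
      unfolding w_def using insert.prems(4) T by (intro koszul_trunc) auto
    also have "\<dots> = mfilter (\<lambda>m. int (tdeg m) < \<sigma> + int (D l) + (\<Sum>i\<in>T. int (D i))) (a l * z T)"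
      using w0[OF T] by (simp add: trunc_def)
    also have "\<dots> = a l * z T"
    proof (rule mfilter_id)
      fix m assume "m \<in> Poly_Mapping.keys (a l * z T)"
      then obtain s t where "m = s + t" "s \<in> Poly_Mapping.keys (a l)" "t \<in> Poly_Mapping.keys (z T)"
        using keys_mult[of "a l" "z T"] by blast
      then show "int (tdeg m) < \<sigma> + int (D l) + (\<Sum>i\<in>T. int (D i))"
        using insert.prems(4)[of l] insert.prems(6) T by (auto simp: homogeneous_def deg_less_def tdeg_add)
    qed
    finally show ?thesis by simp
  qed
  define c where "c = glue l z w"
  have c: "cocycle a (insert l I) r c"
    unfolding c_def using fin l insert.prems(5) w by (intro cocycle_glue)
  have c_eq: "c T = z T" if "T \<subseteq> I" for T
    using that l by (auto simp: c_def glue_def)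
  have "deg_less D \<sigma> (insert l I) c"
    unfolding deg_less_def
  proof (intro allI impI ballI)
    fix T m assume T: "T \<subseteq> insert l I" and m: "m \<in> Poly_Mapping.keys (c T)"
    from T l fin show "int (tdeg m) < \<sigma> + (\<Sum>i\<in>T. int (D i))"
    proof (cases rule: subset_insert_cases)
      case 1
      then show ?thesis using m c_eq insert.prems(6) by (simp add: deg_less_def)
    next
      case (2 T')
      have "Poly_Mapping.keys (ksign l T' * w T') \<subseteq> Poly_Mapping.keys (w T')"
        by (cases "even (card {j\<in>T'. j < l})") (simp_all add: ksign_def)
      then have "m \<in> Poly_Mapping.keys (w T')"
        using m 2 by (auto simp: c_def glue_def)
      then show ?thesis using 2 by (simp add: w_def trunc_def keys_mfilter)
    qed
  qed
  \<comment> \<open>Annihilation passes from z to c because restriction to I is injective on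
    cohomology in degree r.\<close>
  moreover have "coboundary a (insert l I) r (\<lambda>T. a l' * c T)" if "l' \<in> F" for l'
  proof (rule coboundary_insert)
    show "cocycle a (insert l I) r (\<lambda>T. a l' * c T)"
      using c by (simp add: cocycle_def koszul_mult)
    have "coboundary a I r (\<lambda>T. a l' * z T)" using insert.prems(7) that by simp
    then show "coboundary a I r (\<lambda>T. a l' * c T)" by (simp add: coboundary_def c_eq)
  qed (use fin l insert.prems(3) in auto)
  moreover have "acyclic_at a (insert l I) j" if "j < r" for j
    using acyclic_at_union[of "{l}" I r a j] that l fin insert.prems(3) by simp
  ultimately obtain c' where "cocycle a (F \<union> insert l I) r c'" "deg_less D \<sigma> (F \<union> insert l I) c'"
    "\<forall>T\<subseteq>insert l I. c' T = c T"
    using insert.IH[of "insert l I" c] insert.hyps insert.prems(2,4) fin c by auto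
  then show ?case using c_eq by (intro exI[of _ c']) (auto simp: subset_insertI2)
qed

text \<open>The annihilated class lifts to a joint cocycle whose component on the forms vanishes for
  degree reasons. The cocycle is then exact, and its component on the variable powers, which is u,
  lies in their ideal.\<close>

lemma socle_degree_bound:
  fixes F :: "nat \<Rightarrow> 'a::comm_ring_1 mpoly"
  assumes hom: "\<And>j. j \<le> n \<Longrightarrow> homogeneous e (F j)"
    and prim: "\<And>i. i \<le> n \<Longrightarrow> \<exists>h. var i ^ N = (\<Sum>j\<le>n. h j * F j)"
    and deg: "\<And>m. m \<in> Poly_Mapping.keys u \<Longrightarrow> tdeg m + Suc n * e < Suc n * N"
    and ann: "\<And>j. j \<le> n \<Longrightarrow> in_powers N {0..n} (F j * u)"
  shows "in_powers N {0..n} u"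
proof -
  \<comment> \<open>The indices 0, ..., n carry the powers of the variables, and n + 1, ..., 2n + 1 the forms F.\<close>
  define a where "a i = (if i \<le> n then var i ^ N else F (i - Suc n))" for i
  define D where "D i = (if i \<le> n then N else e)" for i
  define I where "I = {0..n}"
  define Y where "Y = {Suc n..Suc (2 * n)}"
  have fin: "finite I" "finite Y" "Y \<inter> I = {}" "I \<inter> Y = {}" "card I = Suc n" "card Y = Suc n"
    by (auto simp: I_def Y_def)
  have homa: "homogeneous (D i) (a i)" if "i \<in> Y \<union> I" for i
    using that hom[of "i - Suc n"] by (auto simp: a_def D_def Y_def I_def homogeneous_var_power)
  have acI: "acyclic_at a I j" if "j < Suc n" for j
    using acyclic_at_var[of "Suc n" a N j] that by (simp add: a_def I_def atLeastLessThanSuc_atLeastAtMost)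
  have imI: "(\<exists>b. v = koszul a b I) \<longleftrightarrow> in_powers N {0..n} v" for v
    unfolding I_def by (intro koszul_image_var_iff) (auto simp: a_def)
  have acY: "acyclic_at a Y j" if "j < Suc n" for j
  proof (rule acyclic_at_remove_union[of I])
    have "acyclic_at a (Y \<union> I) j" using fin acI that by (intro acyclic_at_union[of Y I "Suc n"])
    then show "acyclic_at a (I \<union> Y) j" by (simp add: Un_commute)
    fix i assume "i \<in> I"
    then obtain h where h: "var i ^ N = (\<Sum>j\<le>n. h j * F j)" using prim by (auto simp: I_def)
    have "(\<Sum>j\<le>n. h j * F j) = (\<Sum>j\<in>Y. h (j - Suc n) * a j)"
      by (rule sum.reindex_bij_witness[of _ "\<lambda>j. j - Suc n" "\<lambda>j. j + Suc n"]) (auto simp: Y_def a_def)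
    with h \<open>i \<in> I\<close> show "\<exists>h. a i = (\<Sum>j\<in>Y. h j * a j)"
      by (intro exI[of _ "\<lambda>j. h (j - Suc n)"]) (simp add: a_def I_def)
  qed (use fin in auto)
  have eqI: "T = I" if "T \<subseteq> I" "card T = Suc n" for T
    using that fin card_subset_eq by metis
  have eqY: "T = Y" if "T \<subseteq> Y" "card T = Suc n" for T
    using that fin card_subset_eq by metis
  define z where "z T = (if T = I then u else 0)" for T
  have "\<exists>c. cocycle a (Y \<union> I) (Suc n) c \<and> deg_less D (- int (Suc n * e)) (Y \<union> I) c \<and> (\<forall>T\<subseteq>I. c T = z T)"
  proof (rule cocycle_lift)
    show "cocycle a I (Suc n) z"
      unfolding cocycle_def by (metis card_mono fin(1,5) not_less_eq_eq order_refl)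
    have "(\<Sum>i\<in>I. int (D i)) = int (Suc n * N)" by (simp add: I_def D_def algebra_simps)
    moreover have "int (tdeg m) < - int (Suc n * e) + int (Suc n * N)"
      if "m \<in> Poly_Mapping.keys u" for m
      using deg[OF that] by linarith
    ultimately show "deg_less D (- int (Suc n * e)) I z"
      by (auto simp: deg_less_def z_def)
    fix l assume "l \<in> Y"
    then have "in_powers N {0..n} (a l * u)" using ann[of "l - Suc n"] by (auto simp: a_def Y_def)
    then obtain b where "a l * u = koszul a b I" using imI by blast
    then show "coboundary a I (Suc n) (\<lambda>T. a l * z T)"
      unfolding coboundary_def by (intro exI[of _ b]) (auto simp: z_def dest: eqI)
  qed (use fin acI homa in auto)
  then obtain c where c: "cocycle a (Y \<union> I) (Suc n) c" "deg_less D (- int (Suc n * e)) (Y \<union> I) c"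
    "\<forall>T\<subseteq>I. c T = z T" by blast
  \<comment> \<open>On Y the shift by -(n + 1)e cancels exactly, so monomials of \<open>c Y\<close>
    would have degree below 0.\<close>
  have "(\<Sum>i\<in>Y. int (D i)) = int (Suc n * e)" by (simp add: Y_def D_def algebra_simps)
  then have "Poly_Mapping.keys (c Y) = {}" using c(2) by (force simp: deg_less_def)
  then have "c Y = 0" by simp
  then have "coboundary a Y (Suc n) c"
    unfolding coboundary_def by (intro exI[of _ "\<lambda>S. 0"]) (auto dest: eqY)
  then have "coboundary a (I \<union> Y) (Suc n) c"
    using fin acY c(1) by (intro coboundary_union) (auto simp: Un_commute)
  then obtain b where "c I = koszul a b I"
    using fin(5) unfolding coboundary_def by blast
  moreover have "c I = u" using c(3) by (simp add: z_def)
  ultimately show ?thesis using imI by blast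
qed

section \<open>Partial derivatives and the Cech complex\<close>

lemma pd_eq_sum:
  assumes "finite A" "Poly_Mapping.keys q \<subseteq> A"
  shows "pd i q = (\<Sum>m\<in>A. Poly_Mapping.single (m - Poly_Mapping.single i 1)
    (of_nat (Poly_Mapping.lookup m i) * Poly_Mapping.lookup q m))"
  unfolding pd_def using assms by (intro sum.mono_neutral_left) (auto simp: in_keys_iff)

lemma pd_add: "pd i (q + r) = pd i q + pd i r"
proof -
  define A where "A = Poly_Mapping.keys q \<union> Poly_Mapping.keys r"
  have "finite A" "Poly_Mapping.keys q \<subseteq> A" "Poly_Mapping.keys r \<subseteq> A" "Poly_Mapping.keys (q + r) \<subseteq> A"
    using keys_add[of q r] by (auto simp: A_def)
  then show ?thesis
    by (simp add: pd_eq_sum[of A] lookup_add distrib_left single_add sum.distrib)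
qed

lemma pd_zero [simp]: "pd i 0 = 0"
  by (simp add: pd_def)

lemma pd_sum: "pd i (\<Sum>j\<in>A. q j) = (\<Sum>j\<in>A. pd i (q j))"
  by (induction A rule: infinite_finite_induct) (simp_all add: pd_add)

lemma pd_single: "pd i (Poly_Mapping.single m c) =
    Poly_Mapping.single (m - Poly_Mapping.single i 1) (of_nat (Poly_Mapping.lookup m i) * c)"
  by (simp add: pd_eq_sum[of "{m}"])

text \<open>Truncated subtraction is harmless: if \<open>var i\<close> is absent from m, the
  coefficient is 0. Both Leibniz terms then sit on the same monomial.\<close>

lemma pd_single_mult_single:
  "pd i (Poly_Mapping.single m c) * Poly_Mapping.single m' c' =
    Poly_Mapping.single (m + m' - Poly_Mapping.single i 1) (of_nat (Poly_Mapping.lookup m i) * c * c')"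
proof (cases "Poly_Mapping.lookup m i = 0")
  case True
  then show ?thesis by (simp add: pd_single)
next
  case False
  then have "m - Poly_Mapping.single i 1 + m' = m + m' - Poly_Mapping.single i 1"
    by (intro poly_mapping_eqI) (auto simp: lookup_add lookup_minus lookup_single when_def)
  then show ?thesis by (simp add: pd_single mult_single)
qed

lemma pd_mult: "pd i (q * r) = pd i q * r + q * pd i r"
proof -
  define s where "s q m = Poly_Mapping.single m (Poly_Mapping.lookup q m)" for q :: "'a mpoly" and m
  have s: "q = (\<Sum>m\<in>Poly_Mapping.keys q. s q m)" for q
    by (simp add: s_def sum_single_lookup)
  have leib: "pd i (s q m * s r m') = pd i (s q m) * s r m' + s q m * pd i (s r m')" for m m'
    using pd_single_mult_single[of i m "Poly_Mapping.lookup q m" m' "Poly_Mapping.lookup r m'"]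
      pd_single_mult_single[of i m' "Poly_Mapping.lookup r m'" m "Poly_Mapping.lookup q m"]
    by (simp add: s_def mult_single pd_single lookup_add algebra_simps flip: single_add)
  have "pd i (q * r) = pd i ((\<Sum>m\<in>Poly_Mapping.keys q. s q m) * (\<Sum>m\<in>Poly_Mapping.keys r. s r m))"
    by (simp flip: s)
  also have "\<dots> = pd i (\<Sum>m\<in>Poly_Mapping.keys q. s q m) * (\<Sum>m\<in>Poly_Mapping.keys r. s r m)
      + (\<Sum>m\<in>Poly_Mapping.keys q. s q m) * pd i (\<Sum>m\<in>Poly_Mapping.keys r. s r m)"
    by (simp only: sum_product pd_sum leib sum.distrib)
  finally show ?thesis by (simp flip: s)
qed

lemma pd_one [simp]: "pd i 1 = 0"
  using pd_single[of i 0 1] by simp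

lemma pd_power: "pd i (q ^ k) = of_nat k * q ^ (k - 1) * pd i q"
proof (induction k)
  case (Suc k)
  then show ?case by (cases k) (simp_all add: pd_mult algebra_simps)
qed simp

lemma homogeneous_pd:
  assumes "homogeneous d q"
  shows "homogeneous (d - 1) (pd i q)"
  unfolding homogeneous_def
proof
  fix m' assume "m' \<in> Poly_Mapping.keys (pd i q)"
  from subsetD[OF keys_sum_subset this[unfolded pd_def]]
  obtain m where m: "m \<in> Poly_Mapping.keys q"
    "m' \<in> Poly_Mapping.keys (Poly_Mapping.single (m - Poly_Mapping.single i 1)
      (of_nat (Poly_Mapping.lookup m i) * Poly_Mapping.lookup q m))"
    by blast
  then have "of_nat (Poly_Mapping.lookup m i) * Poly_Mapping.lookup q m \<noteq> 0"
    and m': "m' = m - Poly_Mapping.single i 1"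
    by (auto split: if_splits)
  then have "Poly_Mapping.lookup m i \<noteq> 0" by (metis mult_zero_left of_nat_0)
  with m' have "m = m' + Poly_Mapping.single i 1"
    by (intro poly_mapping_eqI) (auto simp: lookup_add lookup_minus lookup_single when_def)
  then have "tdeg m = tdeg m' + 1" by (metis tdeg_add tdeg_single)
  with assms m(1) show "tdeg m' = d - 1" by (auto simp: homogeneous_def)
qed

text \<open>The derivative of \<open>var j ^ N\<close> carries the factor N, which is 0, so only the
  coefficients get differentiated.\<close>

lemma in_powers_pd:
  fixes q :: "'a::comm_ring_1 mpoly"
  assumes "CHAR('a) dvd N" "in_powers N A q"
  shows "in_powers N A (pd i q)"
proof -
  obtain b where b: "q = (\<Sum>j\<in>A. b j * var j ^ N)" using assms(2) by (auto simp: in_powers_def)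
  have "(of_nat N :: 'a mpoly) = 0" using assms(1) by (simp add: of_nat_eq_0_iff_char_dvd CHAR_mpoly)
  then have "pd i q = (\<Sum>j\<in>A. pd i (b j) * var j ^ N)"
    by (simp add: b pd_sum pd_mult pd_power)
  then show ?thesis unfolding in_powers_def by (intro exI[of _ "\<lambda>j. pd i (b j)"])
qed

section \<open>The connecting map on Cech classes\<close>

lemma cech_num_eq_koszul: "cech_num k g T = koszul (\<lambda>i. var i ^ k) g T"
  by (simp add: cech_num_def koszul_def ksign_def mult_ac)

lemma X_eq_var_mult: "finite T \<Longrightarrow> i \<in> T \<Longrightarrow> X T = var i * X (T - {i})"
  by (simp add: X_def prod.remove)

lemma var_nonzero [simp]: "(var i :: 'a::comm_ring_1 mpoly) \<noteq> 0"
  by (metis var_def keys_single keys_zero insert_not_empty zero_neq_one)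

text \<open>The connecting map is well defined: if g differs from dh by multiples of f, the
  differential kills dh, and cancelling f exhibits q in the ideal.\<close>

lemma class_zero_imp_in_powers:
  fixes f :: "'a::idom mpoly"
  assumes "f \<noteq> 0" and q: "X {0..n} ^ e * cech_num k g {0..n} = q * f"
    and zero: "class_zero_n n f k g"
  shows "in_powers (k + e) {0..n} q"
proof -
  obtain m h where "k \<le> m" and
    lz: "\<And>i. i \<le> n \<Longrightarrow> loc_zero n f (Sn n i) (g (Sn n i) * X (Sn n i) ^ (m - k) - cech_num m h (Sn n i))"
    using zero unfolding class_zero_n_def by blast
  define w where "w i = g (Sn n i) * X (Sn n i) ^ (m - k) - cech_num m h (Sn n i)" for i
  have "\<forall>i. \<exists>e q. i \<le> n \<longrightarrow> X (Sn n i) ^ e * w i = q * f"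
    using lz unfolding loc_zero_def w_def by blast
  then obtain \<epsilon> where "\<forall>i. \<exists>q. i \<le> n \<longrightarrow> X (Sn n i) ^ \<epsilon> i * w i = q * f" by metis
  then obtain r where r: "\<And>i. i \<le> n \<Longrightarrow> X (Sn n i) ^ \<epsilon> i * w i = r i * f" by metis
  define E where "E = (\<Sum>i\<le>n. \<epsilon> i)"
  have E: "\<epsilon> i \<le> E" if "i \<le> n" for i
    unfolding E_def using that by (intro member_le_sum) auto
  define s where "s = (\<Sum>i\<in>{0..n}. ksign i {0..n} * r i * X (Sn n i) ^ (E - \<epsilon> i) * var i ^ (m + E))"
  have XI: "X {0..n} = var i * X (Sn n i)" if "i \<le> n" for i
    using that by (intro X_eq_var_mult) auto
  have "s * f = (\<Sum>i\<in>{0..n}. X {0..n} ^ E * (ksign i {0..n} * var i ^ m * w i))"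
    unfolding s_def sum_distrib_right
  proof (rule sum.cong, rule refl)
    fix i assume "i \<in> {0..n}"
    then have i: "i \<le> n" by simp
    have "ksign i {0..n} * r i * X (Sn n i) ^ (E - \<epsilon> i) * var i ^ (m + E) * f
        = ksign i {0..n} * var i ^ (m + E) * X (Sn n i) ^ (E - \<epsilon> i) * (r i * f)"
      by (simp add: mult_ac)
    also have "\<dots> = ksign i {0..n} * var i ^ (m + E) * (X (Sn n i) ^ (E - \<epsilon> i) * X (Sn n i) ^ \<epsilon> i) * w i"
      unfolding r[OF i, symmetric] by (simp only: mult_ac)
    also have "X (Sn n i) ^ (E - \<epsilon> i) * X (Sn n i) ^ \<epsilon> i = (X (Sn n i) ^ E :: 'a mpoly)"
      using E[OF i] by (simp flip: power_add)
    finally show "ksign i {0..n} * r i * X (Sn n i) ^ (E - \<epsilon> i) * var i ^ (m + E) * f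
        = X {0..n} ^ E * (ksign i {0..n} * var i ^ m * w i)"
      by (simp add: XI[OF i] power_add power_mult_distrib mult_ac)
  qed
  also have "\<dots> = X {0..n} ^ E * (\<Sum>i\<in>{0..n}. X {0..n} ^ (m - k) * (ksign i {0..n} * var i ^ k * g (Sn n i))
      - ksign i {0..n} * var i ^ m * cech_num m h (Sn n i))"
    unfolding sum_distrib_left
  proof (rule sum.cong, rule refl)
    fix i assume "i \<in> {0..n}"
    then have i: "i \<le> n" by simp
    have "(var i ^ m :: 'a mpoly) = var i ^ (m - k) * var i ^ k"
      using \<open>k \<le> m\<close> by (simp flip: power_add)
    then show "X {0..n} ^ E * (ksign i {0..n} * var i ^ m * w i) =
        X {0..n} ^ E * (X {0..n} ^ (m - k) * (ksign i {0..n} * var i ^ k * g (Sn n i))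
      - ksign i {0..n} * var i ^ m * cech_num m h (Sn n i))"
      by (simp add: w_def XI[OF i] power_mult_distrib algebra_simps)
  qed
  also have "\<dots> = X {0..n} ^ E * (X {0..n} ^ (m - k) * cech_num k g {0..n}
      - koszul (\<lambda>i. var i ^ m) (koszul (\<lambda>i. var i ^ m) h) {0..n})"
    by (simp add: sum_subtractf cech_num_eq_koszul koszul_def sum_distrib_left)
  also have "\<dots> = X {0..n} ^ (E + (m - k)) * cech_num k g {0..n}"
    by (simp add: koszul_koszul power_add mult_ac)
  finally have "X {0..n} ^ e * s * f = X {0..n} ^ (E + (m - k)) * (X {0..n} ^ e * cech_num k g {0..n})"
    by (simp add: mult_ac)
  then have "X {0..n} ^ e * s * f = X {0..n} ^ (E + (m - k)) * q * f"
    by (simp only: q mult.assoc)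
  then have eq: "X {0..n} ^ e * s = X {0..n} ^ (E + (m - k)) * q" using \<open>f \<noteq> 0\<close> by simp
  have "in_powers (m + E) {0..n} s" unfolding in_powers_def s_def
    by (intro exI[of _ "\<lambda>i. ksign i {0..n} * r i * X (Sn n i) ^ (E - \<epsilon> i)"] refl)
  then have "in_powers (m + E + e) {0..n} (X {0..n} ^ e * s)" by (simp add: in_powers_X_mult)
  moreover have "m + E + e = (k + e) + (E + (m - k))" using \<open>k \<le> m\<close> by simp
  ultimately have "in_powers ((k + e) + (E + (m - k))) {0..n} (X {0..n} ^ (E + (m - k)) * q)"
    by (simp only: eq)
  then show ?thesis by (subst (asm) in_powers_X_mult) auto
qed

lemma keys_add_nat: "Poly_Mapping.keys (m + m') = Poly_Mapping.keys m \<union> Poly_Mapping.keys m'"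
  for m m' :: "'b \<Rightarrow>\<^sub>0 nat"
  by (auto simp: in_keys_iff lookup_add)

lemma in_R_mult: "in_R n q \<Longrightarrow> in_R n r \<Longrightarrow> in_R n (q * r)"
  using keys_mult[of q r] by (fastforce simp: in_R_def keys_add_nat)

lemma in_R_one [simp]: "in_R n 1"
  by (simp add: in_R_def)

lemma in_R_power: "in_R n q \<Longrightarrow> in_R n (q ^ k)" for q :: "'a::comm_ring_1 mpoly"
  by (induction k) (auto intro: in_R_mult)

lemma in_R_diff: "in_R n q \<Longrightarrow> in_R n r \<Longrightarrow> in_R n (q - r)" for q :: "'a::comm_ring_1 mpoly"
  using keys_add[of q "- r"] by (fastforce simp: in_R_def)

lemma in_R_ksign [simp]: "in_R n (ksign i T :: 'a::comm_ring_1 mpoly)"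
proof -
  have "in_R n (- 1 :: 'a mpoly)" by (simp add: in_R_def)
  then show ?thesis unfolding ksign_def by (rule in_R_power)
qed

lemma in_R_var: "i \<le> n \<Longrightarrow> in_R n (var i :: 'a::comm_ring_1 mpoly)"
  by (auto simp: in_R_def var_def)

lemma in_R_X: "T \<subseteq> {0..n} \<Longrightarrow> in_R n (X T :: 'a::comm_ring_1 mpoly)"
proof (induction T rule: infinite_finite_induct)
  case (insert i T)
  then show ?case by (auto simp: X_def intro!: in_R_mult in_R_var)
qed (simp_all add: X_def)

text \<open>
  Exactness is proved in the ring with infinitely many variables; this R-linear retraction brings the
  witnesses back into R.
\<close>
definition restrict_R :: "nat \<Rightarrow> 'a::zero mpoly \<Rightarrow> 'a mpoly" where
  "restrict_R n = mfilter (\<lambda>m. Poly_Mapping.keys m \<subseteq> {0..n})"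

lemma in_R_restrict_R [simp]: "in_R n (restrict_R n q)"
  by (simp add: in_R_def restrict_R_def keys_mfilter)

lemma restrict_R_id: "in_R n q \<Longrightarrow> restrict_R n q = q"
  unfolding restrict_R_def by (rule mfilter_id) (simp add: in_R_def)

lemma restrict_R_mult: "in_R n a \<Longrightarrow> restrict_R n (a * q) = a * restrict_R n q"
  unfolding restrict_R_def by (rule mfilter_mult) (simp add: in_R_def keys_add_nat)

lemma restrict_R_sum: "restrict_R n (\<Sum>i\<in>A. q i) = (\<Sum>i\<in>A. restrict_R n (q i))"
  unfolding restrict_R_def by (rule mfilter_sum)

text \<open>The connecting map is injective: expanding q in the variable powers shows which
  multiples of f to subtract from g to get a cocycle over polynomials. That cocycle is exact in
  degree n.\<close>

lemma in_powers_imp_class_zero: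
  fixes f :: "'a::comm_ring_1 mpoly"
  assumes "in_R n f" "cochain_n n k g" "in_R n q"
    and q: "X {0..n} ^ e * cech_num k g {0..n} = q * f"
    and pow: "in_powers (k + e) {0..n} q"
  shows "class_zero_n n f k g"
proof -
  define I where "I = {0..n}"
  define a where "a = (\<lambda>i. var i ^ (k + e) :: 'a mpoly)"
  obtain b0 where b0: "q = (\<Sum>i\<in>I. b0 i * a i)" using pow by (auto simp: in_powers_def I_def a_def)
  define b where "b i = restrict_R n (b0 i)" for i
  have aR: "in_R n (a i)" if "i \<in> I" for i
    using that by (auto simp: a_def I_def intro: in_R_power in_R_var)
  have "restrict_R n q = (\<Sum>i\<in>I. b i * a i)"
    unfolding b0 restrict_R_sum b_def
    by (intro sum.cong refl) (metis aR mult.commute restrict_R_mult)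
  then have b: "q = (\<Sum>i\<in>I. b i * a i)" using \<open>in_R n q\<close> by (simp add: restrict_R_id)
  define c where "c S = g S * X S ^ e - ksign (the_elem (I - S)) I * b (the_elem (I - S)) * f" for S
  have the: "the_elem (I - (I - {i})) = i" if "i \<in> I" for i
    using that by (simp add: double_diff)
  have c: "c (I - {i}) = g (I - {i}) * X (I - {i}) ^ e - ksign i I * b i * f" if "i \<in> I" for i
    by (simp add: c_def the[OF that])
  have cR: "in_R n (c (I - {i}))" if "i \<in> I" for i
    unfolding c[OF that] using that assms(1,2)
    by (auto intro!: in_R_diff in_R_mult in_R_power in_R_X simp: b_def cochain_n_def I_def)
  have "koszul a c I = (\<Sum>i\<in>I. X I ^ e * (ksign i I * var i ^ k * g (I - {i})) - b i * a i * f)"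
    unfolding koszul_def
  proof (rule sum.cong, rule refl)
    fix i assume i: "i \<in> I"
    have "X I ^ e = var i ^ e * (X (I - {i}) ^ e :: 'a mpoly)"
      using i by (subst X_eq_var_mult[of I i]) (auto simp: I_def power_mult_distrib)
    then show "ksign i I * a i * c (I - {i}) = X I ^ e * (ksign i I * var i ^ k * g (I - {i})) - b i * a i * f"
      by (simp add: c[OF i] a_def power_add algebra_simps)
  qed
  also have "\<dots> = X I ^ e * cech_num k g I - q * f"
    by (simp add: sum_subtractf cech_num_eq_koszul koszul_def b sum_distrib_left sum_distrib_right)
  also have "\<dots> = 0" using q by (simp add: I_def)
  finally have "koszul a c I = 0" .
  moreover have "T = I" if "T \<subseteq> I" "card T = Suc n" for T
    using that card_subset_eq[of I T] by (simp add: I_def)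
  ultimately have "cocycle a I n c" by (auto simp: cocycle_def)
  moreover have "acyclic_at a I n"
    using acyclic_at_var[of "Suc n" a "k + e" n]
    by (simp add: a_def I_def atLeastLessThanSuc_atLeastAtMost)
  ultimately obtain h0 where h0: "\<And>T. T \<subseteq> I \<Longrightarrow> card T = n \<Longrightarrow> c T = koszul a h0 T"
    by (auto simp: acyclic_at_def coboundary_def)
  define h where "h U = restrict_R n (h0 U)" for U
  have h: "koszul a h (I - {i}) = c (I - {i})" if i: "i \<in> I" for i
  proof -
    have "c (I - {i}) = restrict_R n (koszul a h0 (I - {i}))"
      using h0[of "I - {i}"] cR[OF i] i by (simp add: restrict_R_id I_def)
    also have "\<dots> = koszul a h (I - {i})"
      unfolding koszul_def restrict_R_sum h_def
      by (intro sum.cong refl restrict_R_mult in_R_mult) (auto intro: aR)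
    finally show ?thesis by simp
  qed
  have "loc_zero n f (Sn n i) (g (Sn n i) * X (Sn n i) ^ (k + e - k) - cech_num (k + e) h (Sn n i))"
    if "i \<le> n" for i
  proof -
    have i: "i \<in> I" using that by (simp add: I_def)
    have "in_R n (ksign i I * b i)" by (auto simp: b_def intro: in_R_mult)
    moreover have "g (I - {i}) * X (I - {i}) ^ (k + e - k) - cech_num (k + e) h (I - {i}) = ksign i I * b i * f"
      using h[OF i] c[OF i] by (simp add: cech_num_eq_koszul a_def)
    ultimately show ?thesis
      unfolding loc_zero_def I_def[symmetric] by (intro exI[of _ 0] exI[of _ "ksign i I * b i"]) simp
  qed
  then show ?thesis unfolding class_zero_n_def
    by (intro exI[of _ "k + e"] conjI exI[of _ h] allI impI) (auto simp: h_def)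
qed

section \<open>Frobenius on numerators and degree bounds\<close>

lemma ksign_power_CHAR:
  assumes "prime CHAR('r::comm_ring_1)"
  shows "(ksign i T :: 'r) ^ CHAR('r) = ksign i T"
proof -
  have "(- 1 :: 'r) ^ CHAR('r) = - 1"
    using minus_power_prime_CHAR[OF refl assms, of 1] by simp
  then show ?thesis unfolding ksign_def by (metis mult.commute power_mult)
qed

lemma cech_num_frobenius:
  fixes g :: "nat set \<Rightarrow> 'a::comm_ring_1 mpoly"
  assumes "prime CHAR('a)"
  shows "cech_num (CHAR('a) * k) (\<lambda>S. g S ^ CHAR('a)) T = cech_num k g T ^ CHAR('a)"
proof -
  have "cech_num k g T ^ CHAR('a) = (\<Sum>i\<in>T. (ksign i T * var i ^ k * g (T - {i})) ^ CHAR('a))"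
    unfolding cech_num_eq_koszul koszul_def
    using assms by (intro freshmans_dream_sum) (auto simp: CHAR_mpoly)
  also have "\<dots> = (\<Sum>i\<in>T. ksign i T * var i ^ (CHAR('a) * k) * g (T - {i}) ^ CHAR('a))"
  proof -
    have "(ksign i T :: 'a mpoly) ^ CHAR('a) = ksign i T" for i
      using ksign_power_CHAR[where 'r = "'a mpoly"] assms by (simp add: CHAR_mpoly)
    then show ?thesis by (simp add: power_mult_distrib mult.commute[of "CHAR('a)"] power_mult)
  qed
  finally show ?thesis by (simp add: cech_num_eq_koszul koszul_def)
qed

lemma tdeg_keys_power:
  fixes q :: "'a::comm_ring_1 mpoly"
  assumes "\<And>m. m \<in> Poly_Mapping.keys q \<Longrightarrow> tdeg m + a \<le> b"
  shows "m \<in> Poly_Mapping.keys (q ^ k) \<Longrightarrow> tdeg m + k * a \<le> k * b"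
proof (induction k arbitrary: m)
  case (Suc k)
  obtain s t where st: "m = s + t" "s \<in> Poly_Mapping.keys q" "t \<in> Poly_Mapping.keys (q ^ k)"
    using Suc.prems keys_mult[of q "q ^ k"] by auto
  show ?case using assms[OF st(2)] Suc.IH[OF st(3)] by (simp add: st(1) tdeg_add)
qed simp

text \<open>The part of q violating the bound, times f, is the part of the product in degrees at
  least b, which is 0. Then f cancels.\<close>

lemma tdeg_less_of_mult_homogeneous:
  fixes f :: "'a::idom mpoly"
  assumes "homogeneous d f" "f \<noteq> 0"
    and deg: "\<And>m. m \<in> Poly_Mapping.keys (q * f) \<Longrightarrow> tdeg m < b"
    and "m \<in> Poly_Mapping.keys q"
  shows "tdeg m + d < b"
proof -
  have "f * mfilter (\<lambda>m. \<not> tdeg m + d < b) q = mfilter (\<lambda>m. \<not> tdeg m < b) (f * q)"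
    using assms(1) by (intro mfilter_mult[symmetric]) (auto simp: homogeneous_def tdeg_add add.commute)
  also have "\<dots> = 0" using deg by (intro mfilter_eq_zero) (simp add: mult.commute)
  finally have "mfilter (\<lambda>m. \<not> tdeg m + d < b) q = 0" using \<open>f \<noteq> 0\<close> by simp
  with assms(4) show ?thesis by (metis (mono_tags, lifting) empty_iff keys_mfilter keys_zero mem_Collect_eq)
qed

text \<open>The denominator of a component has degree kn; the factor \<open>var i ^ k\<close>
  completes it to n + 1 variables.\<close>

lemma tdeg_cech_num:
  fixes g :: "nat set \<Rightarrow> 'a::comm_ring_1 mpoly"
  assumes "negative_n n k g" "m \<in> Poly_Mapping.keys (X {0..n} ^ e * cech_num k g {0..n})"
  shows "tdeg m < (k + e) * Suc n"
proof -
  let ?t = "\<Sum>i\<in>{0..n}. Poly_Mapping.single i e"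
  obtain m1 where m1: "m = ?t + m1" "m1 \<in> Poly_Mapping.keys (cech_num k g {0..n})"
    using assms(2) by (auto simp: X_power keys_monomial_mult)
  obtain i where i: "i \<in> {0..n}" "m1 \<in> Poly_Mapping.keys (ksign i {0..n} * var i ^ k * g (Sn n i))"
    using subsetD[OF keys_sum_subset m1(2)[unfolded cech_num_eq_koszul koszul_def]] by auto
  then obtain s t where st: "m1 = s + t" "s \<in> Poly_Mapping.keys (ksign i {0..n} * var i ^ k :: 'a mpoly)"
    "t \<in> Poly_Mapping.keys (g (Sn n i))"
    using keys_mult[of "ksign i {0..n} * var i ^ k" "g (Sn n i)"] by auto
  have "homogeneous (0 + k) (ksign i {0..n} * var i ^ k :: 'a mpoly)"
    by (intro homogeneous_mult homogeneous_var_power homogeneous_ksign)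
  then have "tdeg s = k" using st by (simp add: homogeneous_def)
  moreover have "tdeg t < k * n" using assms(1) i st by (auto simp: negative_n_def)
  moreover have "tdeg ?t = Suc n * e" by (simp add: tdeg_sum)
  ultimately show ?thesis by (simp add: m1 st tdeg_add algebra_simps)
qed

section \<open>Frobenius\<close>

lemma in_powers_of_nat_cancel:
  fixes v :: "'a::field mpoly"
  assumes "of_nat k \<noteq> (0 :: 'a)" "in_powers N A (of_nat k * v)"
  shows "in_powers N A v"
proof -
  have "of_nat k = Poly_Mapping.single (0 :: nat \<Rightarrow>\<^sub>0 nat) (of_nat k :: 'a)"
    by (rule single_of_nat[symmetric])
  then have "Poly_Mapping.single 0 (inverse (of_nat k)) * of_nat k = (1 :: 'a mpoly)"
    using assms(1) by (simp add: mult_single del: single_of_nat)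
  moreover have "in_powers N A (Poly_Mapping.single 0 (inverse (of_nat k)) * (of_nat k * v))"
    using assms(2) by (rule in_powers_mult)
  ultimately show ?thesis by (simp flip: mult.assoc)
qed

text \<open>The bound on p enters here: td \<le> pd - 2d, and (n + 1)(d - 1) - 2d = (nd - d - n) - 1
  < p.\<close>

lemma degree_inequality:
  fixes n d p t :: nat
  assumes "int p \<ge> int n * int d - int d - int n" "Suc t < p" "d > 0"
  shows "t * d + Suc n * (d - 1) < p * (d + 1)"
proof -
  have "(t + 2) * d \<le> p * d" using assms(2) by (intro mult_right_mono) auto
  then have "int t * int d + 2 * int d \<le> int p * int d"
    by (metis (no_types, lifting) distrib_right of_nat_add of_nat_le_iff of_nat_mult of_nat_numeral)
  then have "int t * int d + (1 + int n) * (int d - 1) < int p * (int d + 1)"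
    using assms(1) by (simp add: algebra_simps)
  moreover have "int (d - 1) = int d - 1" using assms(3) by linarith
  ultimately have "int (t * d + Suc n * (d - 1)) < int (p * (d + 1))"
    by (simp only: of_nat_add of_nat_mult of_nat_Suc of_nat_1)
  then show ?thesis by (simp only: of_nat_less_iff)
qed

text \<open>This is injectivity of Frobenius after the connecting map; the twist by -d turns
  negative degree into \<open>deg\<close>.\<close>

lemma in_powers_of_frobenius:
  fixes f q :: "'a::field mpoly" and n d p K :: nat
  assumes char: "CHAR('a) = p" and ppos: "p > 0" and "f \<noteq> 0" "d > 0"
    and hom: "homogeneous d f" and jac: "jacobian_m_primary n f"
    and pbound: "int p \<ge> int n * int d - int d - int n"
    and deg: "\<And>m. m \<in> Poly_Mapping.keys q \<Longrightarrow> tdeg m + d < K * Suc n"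
    and frob: "in_powers (p * K) {0..n} (f ^ (p - 1) * q ^ p)"
  shows "in_powers K {0..n} q"
proof (rule ccontr)
  assume not_in: "\<not> in_powers K {0..n} q"
  have prime: "prime p" using char ppos prime_CHAR_semidom[where 'a = 'a] by simp
  define P where "P s \<longleftrightarrow> in_powers (p * K) {0..n} (f ^ s * q ^ p)" for s
  have "\<not> P 0"
    using in_powers_frobeniusD[of "{0..n}" K q] not_in prime char by (auto simp: P_def)
  moreover have "P (p - 1)" using frob by (simp add: P_def)
  ultimately obtain t where t: "t < p - 1" "\<not> P t" "P (Suc t)"
    using ex_least_nat_less[of P "p - 1"] by blast
  define u where "u = f ^ t * q ^ p"
  have ofp: "(of_nat p :: 'a mpoly) = 0"
    using char by (simp add: of_nat_eq_0_iff_char_dvd CHAR_mpoly)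
  \<comment> \<open>The factor t + 1 from differentiating \<open>f ^ Suc t\<close> is a
    unit.\<close>
  have "\<not> p dvd Suc t" using t(1) by (auto dest: dvd_imp_le)
  then have unit: "of_nat (Suc t) \<noteq> (0 :: 'a)"
    unfolding of_nat_eq_0_iff_char_dvd char .
  have ann: "in_powers (p * K) {0..n} (pd j f * u)" for j
  proof -
    have "in_powers (p * K) {0..n} (pd j (f ^ Suc t * q ^ p))"
      using t(3) char by (intro in_powers_pd) (auto simp: P_def)
    moreover have "pd j (f ^ Suc t * q ^ p) = of_nat (Suc t) * (pd j f * u)"
      unfolding pd_mult pd_power ofp u_def by (simp add: mult_ac)
    ultimately show ?thesis using in_powers_of_nat_cancel[OF unit] by simp
  qed
  obtain M where M: "\<And>i. i \<le> n \<Longrightarrow> \<exists>h. var i ^ M = (\<Sum>j\<le>n. h j * pd j f)"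
    using jac unfolding jacobian_m_primary_def by blast
  \<comment> \<open>\<open>x\<^sub>i\<^sup>p\<^sup>K\<close> need not lie in the Jacobian ideal, so the fraction is expanded by \<open>(x\<^sub>0 \<cdots> x\<^sub>n)\<^sup>M\<close>.\<close>
  have "in_powers (p * K + M) {0..n} (X {0..n} ^ M * u)"
  proof (rule socle_degree_bound)
    show "homogeneous (d - 1) (pd j f)" for j using hom by (rule homogeneous_pd)
    show "in_powers (p * K + M) {0..n} (pd j f * (X {0..n} ^ M * u))" for j
      using ann[of j] in_powers_X_mult[of "{0..n}" "p * K" M "pd j f * u"] by (simp add: mult_ac)
    fix i assume "i \<le> n"
    with M obtain h where h: "var i ^ M = (\<Sum>j\<le>n. h j * pd j f)" by blast
    have "var i ^ (p * K + M) = (\<Sum>j\<le>n. (var i ^ (p * K) * h j) * pd j f)"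
      by (simp add: power_add h sum_distrib_left mult.assoc)
    then show "\<exists>h. var i ^ (p * K + M) = (\<Sum>j\<le>n. h j * pd j f)"
      by (intro exI[of _ "\<lambda>j. var i ^ (p * K) * h j"])
  next
    fix m assume "m \<in> Poly_Mapping.keys (X {0..n} ^ M * u)"
    then obtain m1 where m1: "m = (\<Sum>i\<in>{0..n}. Poly_Mapping.single i M) + m1" "m1 \<in> Poly_Mapping.keys u"
      by (auto simp: X_power keys_monomial_mult)
    then obtain s r where sr: "m1 = s + r" "s \<in> Poly_Mapping.keys (f ^ t)" "r \<in> Poly_Mapping.keys (q ^ p)"
      using keys_mult[of "f ^ t" "q ^ p"] by (auto simp: u_def)
    have "tdeg s = t * d" using homogeneous_power[OF hom, of t] sr by (simp add: homogeneous_def)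
    \<comment> \<open>The strict bound \<open>deg\<close> gives d + 1 for each factor q; the
      resulting extra p is what \<open>degree_inequality\<close> needs.\<close>
    moreover have "tdeg r + p * (d + 1) \<le> p * (K * Suc n)"
      using tdeg_keys_power[of q "d + 1" "K * Suc n" r p] deg sr by fastforce
    moreover have "t * d + Suc n * (d - 1) < p * (d + 1)"
      using pbound t(1) \<open>d > 0\<close> by (intro degree_inequality) auto
    moreover have "tdeg (\<Sum>i\<in>{0..n}. Poly_Mapping.single i M) = Suc n * M" by (simp add: tdeg_sum)
    moreover have "Suc n * (p * K + M) = p * (K * Suc n) + Suc n * M" by (simp add: algebra_simps)
    ultimately show "tdeg m + Suc n * (d - 1) < Suc n * (p * K + M)"
      by (simp only: m1 sr tdeg_add)
  qed
  then have "in_powers (p * K) {0..n} u" by (simp add: in_powers_X_mult)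
  with t(2) show False by (simp add: P_def u_def)
qed

text \<open>If all derivatives vanished, as they do for f = 0 or d = 0, a power of
  \<open>var 0\<close> would be 0.\<close>

lemma jacobian_m_primary_nonzero:
  fixes f :: "'a::idom mpoly"
  assumes "jacobian_m_primary n f" "homogeneous d f"
  shows "f \<noteq> 0" "d > 0"
proof -
  have nz: "\<not> (\<forall>j. pd j f = 0)"
  proof
    assume *: "\<forall>j. pd j f = 0"
    obtain N h where "var 0 ^ N = (\<Sum>j\<le>n. h j * pd j f)"
      using assms(1) unfolding jacobian_m_primary_def by blast
    with * show False by simp
  qed
  then show "f \<noteq> 0" by auto
  show "d > 0"
  proof (rule ccontr)
    assume "\<not> d > 0"
    then have "Poly_Mapping.lookup m j = 0" if "m \<in> Poly_Mapping.keys f" for m j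
      using assms(2) that by (auto simp: homogeneous_def tdeg_def in_keys_iff)
    then have "\<forall>j. pd j f = 0" by (simp add: pd_def)
    with nz show False by blast
  qed
qed

text \<open>Frobenius raises numerators to the p-th power and multiplies the exponent by p. It is
  additive, so injectivity means trivial kernel.\<close>

theorem theorem3p5:
  fixes f :: "'a::field mpoly" and n d p :: nat
  assumes char: "CHAR('a) = p" and ppos: "p > 0"
    and fR: "in_R n f" and hom: "homogeneous d f"
    and jac: "jacobian_m_primary n f"
    and pbound: "int p \<ge> int n * int d - int d - int n"
  shows "\<forall>k g. cochain_n n k g \<and> cocycle_n n f k g \<and> negative_n n k g \<and>
                class_zero_n n f (p * k) (\<lambda>S. g S ^ p)
             \<longrightarrow> class_zero_n n f k g"
proof (intro allI impI, elim conjE)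
  fix k and g :: "nat set \<Rightarrow> 'a mpoly"
  assume g: "cochain_n n k g" "cocycle_n n f k g" "negative_n n k g"
    and zero: "class_zero_n n f (p * k) (\<lambda>S. g S ^ p)"
  note nz = jacobian_m_primary_nonzero[OF jac hom]
  have prime: "prime CHAR('a)" using char ppos prime_CHAR_semidom[where 'a = 'a] by simp
  \<comment> \<open>The connecting map sends the class of g to the fraction with numerator q and
    denominator \<open>X {0..n} ^ (k + e)\<close>.\<close>
  obtain e q where q: "in_R n q" "X {0..n} ^ e * cech_num k g {0..n} = q * f"
    using g(2) unfolding cocycle_n_def loc_zero_def by blast
  have deg: "tdeg m + d < (k + e) * Suc n" if "m \<in> Poly_Mapping.keys q" for m
  proof (rule tdeg_less_of_mult_homogeneous[OF hom nz(1) _ that])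
    fix m assume "m \<in> Poly_Mapping.keys (q * f)"
    then show "tdeg m < (k + e) * Suc n" using tdeg_cech_num[OF g(3)] by (simp only: q(2)[symmetric])
  qed
  \<comment> \<open>The same recipe for the Frobenius image yields the numerator
    \<open>f ^ (p - 1) * q ^ p\<close>.\<close>
  have "X {0..n} ^ (p * e) * cech_num (p * k) (\<lambda>S. g S ^ p) {0..n}
      = (X {0..n} ^ e * cech_num k g {0..n}) ^ p"
    using cech_num_frobenius[OF prime, of k g "{0..n}", unfolded char]
    by (simp only: power_mult_distrib mult.commute[of p e] power_mult[of _ e p])
  also have "\<dots> = (f ^ (p - 1) * q ^ p) * f"
    unfolding q(2) using ppos by (cases p) (simp_all add: power_mult_distrib)
  finally have "in_powers (p * k + p * e) {0..n} (f ^ (p - 1) * q ^ p)"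
    using zero by (rule class_zero_imp_in_powers[OF nz(1)])
  then have "in_powers (p * (k + e)) {0..n} (f ^ (p - 1) * q ^ p)" by (simp add: distrib_left)
  with deg have "in_powers (k + e) {0..n} q"
    by (rule in_powers_of_frobenius[OF char ppos nz hom jac pbound])
  with fR g(1) q show "class_zero_n n f k g" by (intro in_powers_imp_class_zero)
qed

end
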